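(* Let $\omega$ be uniformly distributed on the unit circle. For $|z|=1$ let $$g(z)=\frac{1}{\sqrt2}\begin{pmatrix} i z^{-1} & i z\\ i z^{-1} & -iz\end{pmatrix}\in SU(2).$$ Then as $k\to\infty$, the distribution of the random matrix $g(\omega^{2^k})g(\omega^{2^{k-1}})\cdots g(\omega)$ converges weakly to Haar probability measure on $SU(2)$. *)

theory Defs
  imports "HOL-Probability.Probability"
begin

type_synonym cmat2 = "complex ^ 2 ^ 2"

definition mat2 :: "complex \<Rightarrow> complex \<Rightarrow> complex \<Rightarrow> complex \<Rightarrow> cmat2" where
  "mat2 a b c d = (\<chi> i j. if i = 1 then (if j = 1 then a else b) else (if j = 1 then c else d))"

definition adjoint2 :: "cmat2 \<Rightarrow> cmat2" where
  "adjoint2 A = (\<chi> i j. cnj (A $ j $ i))"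

definition SU2 :: "cmat2 set" where
  "SU2 = {A. A ** adjoint2 A = mat 1 \<and> det A = 1}"

definition gmat :: "complex \<Rightarrow> cmat2" where
  "gmat z =
     mat2 (\<i> * inverse z / sqrt 2) (\<i> * z / sqrt 2) (\<i> * inverse z / sqrt 2) (- \<i> * z / sqrt 2)"

fun gprod :: "nat \<Rightarrow> complex \<Rightarrow> cmat2" where
  "gprod 0 z = gmat z"
| "gprod (Suc k) z = gmat (z ^ (2 ^ Suc k)) ** gprod k z"

definition circle_unif :: "complex measure" where
  "circle_unif = distr (uniform_measure lborel {0..1::real}) borel (\<lambda>t. cis (2 * pi * t))"

definition haar_SU2 :: "cmat2 measure \<Rightarrow> bool" where
  "haar_SU2 \<mu> \<longleftrightarrow> prob_space \<mu> \<and> sets \<mu> = sets borel \<and> \<mu> SU2 = 1 \<and>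
     (\<forall>g\<in>SU2. distr \<mu> borel (\<lambda>A. g ** A) = \<mu>)"

definition weak_conv_bc :: "(nat \<Rightarrow> 'a::topological_space measure) \<Rightarrow> 'a measure \<Rightarrow> bool" where
  "weak_conv_bc M \<mu> \<longleftrightarrow> (\<forall>f :: 'a \<Rightarrow> real. continuous_on UNIV f \<and> bounded (range f) \<longrightarrow>
      (\<lambda>k. integral\<^sup>L (M k) f) \<longlonglongrightarrow> integral\<^sup>L \<mu> f)"

end

(* With H = gmat 1 and z on the circle, gmat z is H composed with diag(1/z, z), and the walk satisfies
   G_(k+1)(z) = G_k(z^2) g(z).  On binary forms of degree n, the Fourier coefficients
   X K k j = E[z^(n - 2k) r_1^j r_2^(n - j)], with r = x^T G_K(z), obey a finite linear recursion: H acts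
   through a Krawtchouk matrix, after which the squaring of z sends the index (k + j) / 2 to k and
   annihilates the coefficients with k + j odd.  The Krawtchouk matrix is unitary for the
   binomial weights, so the weighted norm of X K is non-increasing in K and the components dropped by the
   recursion tend to 0.  Induction on k then gives X K k j --> 0: in the limit, X K k is supported on j >= k and its
   image under H on j <= k, so its generating polynomial is a multiple of t^k (t - 1)^(n - k).  For k < n the
   coefficient of t^(k + 1) in it does not vanish but should by parity; for k = n the component j = 0 is dropped.

   Hence E (x^T G_K y)^n --> 0 for n >= 1.  The Haar integral of (x^T A y)^n vanishes as well, and on SU(2)
   these functions span the algebra of polynomials in the matrix entries, so Stone-Weierstrass applies.
   A Haar measure is obtained by normalizing a uniformly distributed point of the unit ball of the
   quaternions. *)

theory Submission
  imports Defs "HOL-Computational_Algebra.Polynomial"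
begin

section \<open>Krawtchouk matrices\<close>

text \<open>For \<open>j \<le> n\<close>, column \<open>j\<close> describes the substitution (a, b)
  -> (a + b, a - b) applied to the monomial a^j b^(n - j). Up to the sign (-1)^(n - j), the entry is
  the Krawtchouk polynomial of degree \<open>l\<close> at \<open>n - j\<close>.\<close>

definition kraw :: "nat \<Rightarrow> nat \<Rightarrow> nat \<Rightarrow> complex" where
  "kraw n l j = coeff ([:1, 1:] ^ j * [:-1, 1:] ^ (n - j)) l"

lemma degree_kraw_poly:
  assumes "j \<le> n"
  shows "degree ([:1, 1:] ^ j * [:-1, 1:] ^ (n - j) :: complex poly) = n"
  using assms by (subst degree_mult_eq) (auto simp: degree_power_eq)

text \<open>Homogenization: the polynomial in \<open>kraw\<close> has degree \<open>n\<close>, and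
  its value at \<open>a / b\<close> times \<open>b ^ n\<close> is the left side.\<close>

lemma kraw_expansion:
  assumes "j \<le> n"
  shows "(a + b) ^ j * (a - b) ^ (n - j) = (\<Sum>l\<le>n. kraw n l j * (a ^ l * b ^ (n - l)))"
proof -
  let ?p = "[:1, 1:] ^ j * [:-1, 1:] ^ (n - j) :: complex poly"
  have deg: "degree ?p = n"
    by (rule degree_kraw_poly[OF assms])
  show ?thesis
  proof (cases "b = 0")
    case True
    \<comment> \<open>With \<open>b = 0\<close> only the term \<open>l = n\<close> survives, so it
      suffices that the polynomial is monic.\<close>
    have "kraw n n j = lead_coeff ?p"
      unfolding kraw_def by (simp only: deg)
    also have "\<dots> = 1"
      by (simp add: lead_coeff_mult lead_coeff_power)
    finally have 1: "kraw n n j = 1" .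
    have "(\<Sum>l\<le>n. kraw n l j * (a ^ l * b ^ (n - l))) = (\<Sum>l\<in>{n}. kraw n l j * (a ^ l * b ^ (n - l)))"
      using True by (intro sum.mono_neutral_right) auto
    then show ?thesis
      using True 1 assms by (simp flip: power_add)
  next
    case False
    have "(a + b) ^ j * (a - b) ^ (n - j) = b ^ n * ((a / b + 1) ^ j * (a / b - 1) ^ (n - j))"
    proof -
      have "b ^ n = b ^ j * b ^ (n - j)"
        using assms by (simp flip: power_add)
      moreover have "a + b = b * (a / b + 1)" "a - b = b * (a / b - 1)"
        using False by (auto simp: field_simps)
      ultimately show ?thesis
        by (simp only: power_mult_distrib mult_ac)
    qed
    also have "(a / b + 1) ^ j * (a / b - 1) ^ (n - j) = poly ?p (a / b)"
      by (simp add: algebra_simps)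
    also have "\<dots> = (\<Sum>l\<le>n. kraw n l j * (a / b) ^ l)"
      by (simp only: poly_altdef deg kraw_def)
    also have "b ^ n * \<dots> = (\<Sum>l\<le>n. kraw n l j * (a ^ l * b ^ (n - l)))"
      unfolding sum_distrib_left using False
      by (intro sum.cong refl) (auto simp: power_divide power_diff field_simps)
    finally show ?thesis .
  qed
qed

text \<open>Both sides are the coefficient of s^j t^l in (s (t + 1) + (t - 1))^n, and the base s t +
  s + t - 1 is symmetric in s and t.\<close>

lemma kraw_sym:
  assumes "j \<le> n" "l \<le> n"
  shows "of_nat (n choose j) * kraw n l j = of_nat (n choose l) * kraw n j l"
proof -
  have "(\<Sum>j\<le>n. (of_nat (n choose j) * kraw n l j) * s ^ j) = (\<Sum>j\<le>n. (of_nat (n choose l) * kraw n j l) * s ^ j)"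
    for s :: complex
  proof -
    have "(\<Sum>j\<le>n. (of_nat (n choose j) * kraw n l j) * s ^ j) =
        coeff (\<Sum>j\<le>n. of_nat (n choose j) * (smult s [:1, 1:]) ^ j * [:-1, 1:] ^ (n - j)) l"
      unfolding coeff_sum kraw_def
      by (intro sum.cong refl) (simp only: smult_power of_nat_poly mult_smult_left mult_pCons_left, simp)
    also have "\<dots> = coeff ((smult s [:1, 1:] + [:-1, 1:]) ^ n) l"
      by (simp only: binomial_ring)
    also have "smult s [:1, 1:] + [:-1, 1:] = [:s - 1, s + 1:]"
      by simp
    also have "coeff ([:s - 1, s + 1:] ^ n) l = of_nat (n choose l) * ((s + 1) ^ l * (s - 1) ^ (n - l))"
      by (subst coeff_linear_poly_power) (use assms in auto)
    also have "\<dots> = (\<Sum>j\<le>n. (of_nat (n choose l) * kraw n j l) * s ^ j)"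
      by (subst kraw_expansion) (use assms in \<open>auto simp: sum_distrib_left algebra_simps\<close>)
    finally show ?thesis .
  qed
  then have "\<forall>i\<le>n. of_nat (n choose i) * kraw n l i = of_nat (n choose l) * kraw n i l"
    by (subst polyfun_eq_coeffs[symmetric]) blast
  then show ?thesis
    using assms by blast
qed

text \<open>Applying (a, b) -> (a + b, a - b) twice gives (2 a, 2 b), which multiplies forms of
  degree \<open>n\<close> by \<open>2 ^ n\<close>.\<close>

lemma kraw_involution:
  assumes "j \<le> n" "i \<le> n"
  shows "(\<Sum>l\<le>n. kraw n i l * kraw n l j) = (if i = j then 2 ^ n else 0)"
proof -
  have "(\<Sum>i\<le>n. (\<Sum>l\<le>n. kraw n i l * kraw n l j) * a ^ i) = (\<Sum>i\<le>n. (if i = j then 2 ^ n else 0) * a ^ i)"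
    for a :: complex
  proof -
    have "(\<Sum>i\<le>n. (\<Sum>l\<le>n. kraw n i l * kraw n l j) * a ^ i) =
        (\<Sum>l\<le>n. kraw n l j * (\<Sum>i\<le>n. kraw n i l * (a ^ i * 1 ^ (n - i))))"
      unfolding sum_distrib_right sum_distrib_left
      by (subst sum.swap) (simp add: algebra_simps)
    also have "\<dots> = (\<Sum>l\<le>n. kraw n l j * ((a + 1) ^ l * (a - 1) ^ (n - l)))"
      by (intro sum.cong refl) (subst kraw_expansion, auto)
    also have "\<dots> = ((a + 1) + (a - 1)) ^ j * ((a + 1) - (a - 1)) ^ (n - j)"
      by (rule kraw_expansion[OF assms(1), symmetric])
    also have "\<dots> = (2 ^ j * 2 ^ (n - j)) * a ^ j"
      by (simp add: power_mult_distrib)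
    also have "2 ^ j * 2 ^ (n - j) = (2 ^ n :: complex)"
      using assms by (simp flip: power_add)
    also have "2 ^ n * a ^ j = (\<Sum>i\<le>n. (if i = j then 2 ^ n else 0) * a ^ i)"
      using assms by (simp add: if_distrib[of "\<lambda>x. x * _"] sum.delta cong: if_cong)
    finally show ?thesis .
  qed
  then have "\<forall>i\<le>n. (\<Sum>l\<le>n. kraw n i l * kraw n l j) = (if i = j then 2 ^ n else 0)"
    by (subst polyfun_eq_coeffs[symmetric]) blast
  then show ?thesis
    using assms by blast
qed

text \<open>For the inner product with binomial weights the map on the left, without
  \<open>c\<close>, is self-adjoint: its entries are real, and \<open>kraw_sym\<close> moves the
  weight to the other index. Its square is \<open>2 ^ n\<close> by \<open>kraw_involution\<close>,
  so scaling by \<open>c\<close> makes it unitary.\<close>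

lemma kraw_norm:
  assumes c: "(cmod c)\<^sup>2 * 2 ^ n = 1"
  shows "(\<Sum>j\<le>n. real (n choose j) * (cmod (c * (\<Sum>l\<le>n. kraw n l j * x l)))\<^sup>2) =
    (\<Sum>j\<le>n. real (n choose j) * (cmod (x j))\<^sup>2)"
proof -
  have cnj: "cnj (kraw n l j) = kraw n l j" for l j
  proof -
    have *: "map_poly cnj (p * q) = map_poly cnj p * map_poly cnj q" for p q
      by (intro poly_eqI) (simp add: coeff_map_poly coeff_mult)
    have **: "map_poly cnj (p ^ k) = map_poly cnj p ^ k" for p k
      by (induction k) (auto simp: * map_poly_1)
    have "cnj (kraw n l j) = coeff (map_poly cnj ([:1, 1:] ^ j * [:-1, 1:] ^ (n - j))) l"
      by (simp add: kraw_def coeff_map_poly)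
    also have "\<dots> = kraw n l j"
      unfolding kraw_def * ** by (simp add: map_poly_pCons)
    finally show ?thesis .
  qed
  let ?b = "\<lambda>j. of_nat (n choose j) :: complex"
  have "complex_of_real (\<Sum>j\<le>n. real (n choose j) * (cmod (c * (\<Sum>l\<le>n. kraw n l j * x l)))\<^sup>2) =
     (\<Sum>j\<le>n. ?b j * ((c * cnj c) * ((\<Sum>l\<le>n. kraw n l j * x l) * (\<Sum>i\<le>n. kraw n i j * cnj (x i)))))"
    unfolding of_real_sum
    by (intro sum.cong refl)
      (simp only: of_real_mult of_real_of_nat_eq complex_norm_square complex_cnj_mult cnj_sum cnj, simp add: algebra_simps)
  also have "\<dots> = (c * cnj c) * (\<Sum>j\<le>n. \<Sum>l\<le>n. \<Sum>i\<le>n. (?b j * kraw n l j) * kraw n i j * x l * cnj (x i))"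
    unfolding sum_product unfolding sum_distrib_left by (intro sum.cong refl) (simp add: algebra_simps)
  also have "(\<Sum>j\<le>n. \<Sum>l\<le>n. \<Sum>i\<le>n. (?b j * kraw n l j) * kraw n i j * x l * cnj (x i))
     = (\<Sum>j\<le>n. \<Sum>l\<le>n. \<Sum>i\<le>n. (?b l * x l * cnj (x i)) * (kraw n i j * kraw n j l))"
    by (intro sum.cong refl) (subst kraw_sym, auto)
  also have "\<dots> = (\<Sum>l\<le>n. \<Sum>i\<le>n. (?b l * x l * cnj (x i)) * (\<Sum>j\<le>n. kraw n i j * kraw n j l))"
    unfolding sum_distrib_left
    by (rule trans[OF sum.swap]) (intro sum.cong[OF refl] sum.swap)
  also have "\<dots> = (\<Sum>l\<le>n. \<Sum>i\<le>n. (?b l * x l * cnj (x i)) * (if i = l then 2 ^ n else 0))"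
    by (intro sum.cong refl) (subst kraw_involution, auto)
  also have "\<dots> = (\<Sum>l\<le>n. 2 ^ n * (?b l * (x l * cnj (x l))))"
    by (simp add: if_distrib[of "\<lambda>x. _ * x"] sum.delta algebra_simps cong: if_cong)
  also have "(c * cnj c) * \<dots> = ((c * cnj c) * 2 ^ n) * (\<Sum>l\<le>n. ?b l * (x l * cnj (x l)))"
    by (simp add: sum_distrib_left algebra_simps)
  also have "(c * cnj c) * 2 ^ n = complex_of_real ((cmod c)\<^sup>2 * 2 ^ n)"
    by (simp only: of_real_mult of_real_power[of 2] complex_norm_square, simp)
  also have "\<dots> = 1"
    by (simp only: c of_real_1)
  also have "1 * (\<Sum>l\<le>n. ?b l * (x l * cnj (x l))) = complex_of_real (\<Sum>j\<le>n. real (n choose j) * (cmod (x j))\<^sup>2)"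
    by (simp only: of_real_sum of_real_mult of_real_of_nat_eq complex_norm_square mult_1)
  finally show ?thesis
    by (simp only: of_real_eq_iff)
qed

text \<open>The constant term of \<open>[:-1, 1:] ^ N\<close> is invertible, so the low coefficients
  of the product determine those of \<open>Q K\<close>. One factor t - 1 is removed at a time, from
  the lowest coefficient up.\<close>

lemma low_coeffs_tendsto_0:
  fixes Q :: "nat \<Rightarrow> complex poly"
  assumes "\<And>l. l < m \<Longrightarrow> (\<lambda>K. coeff ([:-1, 1:] ^ N * Q K) l) \<longlonglongrightarrow> 0" "l < m"
  shows "(\<lambda>K. coeff (Q K) l) \<longlonglongrightarrow> 0"
  using assms
proof (induction N arbitrary: l)
  case 0
  then show ?case by simp
next
  case (Suc N)
  have "(\<lambda>K. coeff ([:-1, 1:] ^ N * Q K) l) \<longlonglongrightarrow> 0" if "l < m" for l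
    using that
  proof (induction l)
    case 0
    then show ?case
      using tendsto_minus[OF Suc.prems(1)[of 0]] by (simp add: coeff_mult)
  next
    case step: (Suc l)
    have "(\<lambda>K. coeff ([:-1, 1:] ^ N * Q K) l - coeff ([:-1, 1:] ^ Suc N * Q K) (Suc l)) \<longlonglongrightarrow> 0 - 0"
      using step.IH step.prems by (intro tendsto_diff Suc.prems(1)) auto
    moreover have "coeff ([:-1, 1:] ^ Suc N * Q K) (Suc l) =
        coeff ([:-1, 1:] ^ N * Q K) l - coeff ([:-1, 1:] ^ N * Q K) (Suc l)" for K
      unfolding power_Suc mult.assoc by simp
    ultimately show ?case
      by simp
  qed
  then show ?case
    using Suc.IH Suc.prems(2) by blast
qed

text \<open>Limit form of a rigidity statement: if (t - 1)^(n - m) q(t) with deg q at most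
  \<open>m\<close> has no terms of degree below \<open>m\<close> and none of degree
  \<open>m + 1\<close>, then q is a multiple of t^m, and the coefficient of t^(m + 1) forces this
  multiple to be 0.\<close>

lemma kraw_tendsto_0:
  fixes Y :: "nat \<Rightarrow> nat \<Rightarrow> complex"
  assumes "m < n"
    and high: "\<And>j. m < j \<Longrightarrow> j \<le> n \<Longrightarrow> (\<lambda>K. Y K j) \<longlonglongrightarrow> 0"
    and low: "\<And>l. l < m \<or> l = Suc m \<Longrightarrow> (\<lambda>K. \<Sum>j\<le>n. kraw n l j * Y K j) \<longlonglongrightarrow> 0"
    and "i \<le> n"
  shows "(\<lambda>K. Y K i) \<longlonglongrightarrow> 0"
proof (cases "m < i")
  case True
  then show ?thesis
    using high \<open>i \<le> n\<close> by blast
next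
  case False
  \<comment> \<open>The columns with \<open>j \<le> m\<close> share the factor (t - 1)^(n - m);
    \<open>Q K\<close> is their combination after division by it.\<close>
  define Q :: "nat \<Rightarrow> complex poly"
    where "Q K = (\<Sum>j\<le>m. smult (Y K j) ([:1, 1:] ^ j * [:-1, 1:] ^ (m - j)))" for K
  have coeff_Q: "coeff (Q K) l = (\<Sum>j\<le>m. kraw m l j * Y K j)" for K l
    by (simp add: Q_def coeff_sum kraw_def mult.commute)
  have deg_Q: "degree (Q K) \<le> m" for K
    unfolding Q_def by (intro degree_sum_le) (auto simp: degree_kraw_poly simp del: mult_pCons_left)
  have coeff_prod: "coeff ([:-1, 1:] ^ (n - m) * Q K) l = (\<Sum>j\<le>m. kraw n l j * Y K j)" for K l
  proof -
    have "[:-1, 1:] ^ (n - m) * Q K = (\<Sum>j\<le>m. smult (Y K j) ([:1, 1:] ^ j * [:-1, 1:] ^ (n - j)))"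
      unfolding Q_def sum_distrib_left
    proof (intro sum.cong refl)
      fix j assume "j \<in> {..m}"
      then have "n - j = (n - m) + (m - j)"
        using \<open>m < n\<close> by simp
      then show "[:- 1, 1:] ^ (n - m) * smult (Y K j) ([:1, 1:] ^ j * [:- 1, 1:] ^ (m - j)) =
          smult (Y K j) ([:1, 1:] ^ j * [:- 1, 1:] ^ (n - j))"
        by (simp only: power_add mult_smult_right mult_ac)
    qed
    then show ?thesis
      by (simp add: coeff_sum kraw_def mult.commute)
  qed
  have prod_lim: "(\<lambda>K. coeff ([:-1, 1:] ^ (n - m) * Q K) l) \<longlonglongrightarrow> 0" if "l < m \<or> l = Suc m" for l
  proof -
    have "(\<lambda>K. (\<Sum>j\<le>n. kraw n l j * Y K j) - (\<Sum>j\<in>{m<..n}. kraw n l j * Y K j)) \<longlonglongrightarrow> 0 - 0"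
      by (intro tendsto_diff low that tendsto_null_sum tendsto_mult_right_zero high) auto
    also have "(\<lambda>K. (\<Sum>j\<le>n. kraw n l j * Y K j) - (\<Sum>j\<in>{m<..n}. kraw n l j * Y K j)) =
        (\<lambda>K. coeff ([:-1, 1:] ^ (n - m) * Q K) l)"
    proof
      fix K
      have "{..n} = {..m} \<union> {m<..n}"
        using \<open>m < n\<close> by auto
      then have "(\<Sum>j\<le>n. kraw n l j * Y K j) = (\<Sum>j\<le>m. kraw n l j * Y K j) + (\<Sum>j\<in>{m<..n}. kraw n l j * Y K j)"
        by (simp only:) (intro sum.union_disjoint, auto)
      then show "(\<Sum>j\<le>n. kraw n l j * Y K j) - (\<Sum>j\<in>{m<..n}. kraw n l j * Y K j) =
          coeff ([:-1, 1:] ^ (n - m) * Q K) l"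
        by (simp add: coeff_prod)
    qed
    finally show ?thesis
      by simp
  qed
  have Q_low: "(\<lambda>K. coeff (Q K) l) \<longlonglongrightarrow> 0" if "l < m" for l
    using low_coeffs_tendsto_0[OF prod_lim that] by blast
  have Q_top: "(\<lambda>K. coeff (Q K) m) \<longlonglongrightarrow> 0"
  proof -
    \<comment> \<open>In the coefficient of degree \<open>Suc m\<close> of the product,
      \<open>a 1\<close> multiplies \<open>coeff (Q K) m\<close>, while
      \<open>coeff (Q K) (Suc m)\<close> vanishes by degree. It can be divided by because
      \<open>m < n\<close> makes it nonzero.\<close>
    define a where "a l = coeff ([:-1, 1:] ^ (n - m) :: complex poly) l" for l
    have "a 1 = of_nat (n - m) * (-1) ^ (n - m - 1)"
      unfolding a_def using \<open>m < n\<close> by (subst coeff_linear_poly_power) auto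
    then have a1: "a 1 \<noteq> 0"
      using \<open>m < n\<close> by auto
    have "coeff (Q K) m = (coeff ([:-1, 1:] ^ (n - m) * Q K) (Suc m) - (\<Sum>l<m. a (Suc m - l) * coeff (Q K) l)) / a 1" for K
    proof -
      have "coeff ([:-1, 1:] ^ (n - m) * Q K) (Suc m) = (\<Sum>l\<le>Suc m. a (Suc m - l) * coeff (Q K) l)"
        unfolding mult.commute[of "[:-1, 1:] ^ (n - m)"] coeff_mult a_def by (simp only: mult.commute)
      also have "\<dots> = (\<Sum>l<m. a (Suc m - l) * coeff (Q K) l) + a 1 * coeff (Q K) m"
        using deg_Q[of K] by (simp add: coeff_eq_0 flip: lessThan_Suc_atMost)
      finally show ?thesis
        using a1 by (simp add: field_simps)
    qed
    moreover have "(\<lambda>K. (coeff ([:-1, 1:] ^ (n - m) * Q K) (Suc m) - (\<Sum>l<m. a (Suc m - l) * coeff (Q K) l)) / a 1)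
        \<longlonglongrightarrow> (0 - 0) / a 1"
      using a1 by (intro tendsto_intros prod_lim tendsto_null_sum tendsto_mult_right_zero Q_low) auto
    ultimately show ?thesis
      by simp
  qed
  \<comment> \<open>All coefficients of \<open>Q K\<close> up to \<open>m\<close> tend to 0, and
    \<open>kraw m\<close> is its own inverse up to \<open>2 ^ m\<close>, which recovers
    \<open>Y K i\<close>.\<close>
  have "(\<lambda>K. (\<Sum>l\<le>m. kraw m i l * coeff (Q K) l) / 2 ^ m) \<longlonglongrightarrow> 0 / 2 ^ m"
  proof (intro tendsto_divide tendsto_const tendsto_null_sum tendsto_mult_right_zero)
    fix l assume "l \<in> {..m}"
    then show "(\<lambda>K. coeff (Q K) l) \<longlonglongrightarrow> 0"
      using Q_low Q_top by (cases "l = m") auto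
  qed auto
  also have "(\<lambda>K. (\<Sum>l\<le>m. kraw m i l * coeff (Q K) l) / 2 ^ m) = (\<lambda>K. Y K i)"
  proof
    fix K
    have "(\<Sum>l\<le>m. kraw m i l * coeff (Q K) l) = (\<Sum>j\<le>m. (\<Sum>l\<le>m. kraw m i l * kraw m l j) * Y K j)"
      unfolding coeff_Q sum_distrib_left sum_distrib_right by (subst sum.swap) (simp add: mult.assoc)
    also have "\<dots> = (\<Sum>j\<le>m. (if i = j then 2 ^ m else 0) * Y K j)"
      using False by (intro sum.cong refl, subst kraw_involution) auto
    also have "\<dots> = 2 ^ m * Y K i"
      using False by (simp add: if_distrib[of "\<lambda>x. x * _"] cong: if_cong)
    finally show "(\<Sum>l\<le>m. kraw m i l * coeff (Q K) l) / 2 ^ m = Y K i"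
      by simp
  qed
  finally show ?thesis
    by simp
qed

lemma kraw_recursion_tendsto_0:
  fixes X :: "nat \<Rightarrow> nat \<Rightarrow> nat \<Rightarrow> complex"
  assumes n: "0 < n" and c: "(cmod c)\<^sup>2 * 2 ^ n = 1"
    and X_even: "\<And>K k j. k \<le> n \<Longrightarrow> j \<le> n \<Longrightarrow> even (k + j) \<Longrightarrow>
      X (Suc K) k j = c * (\<Sum>l\<le>n. kraw n l j * X K ((k + j) div 2) l)"
    and X_odd: "\<And>K k j. k \<le> n \<Longrightarrow> j \<le> n \<Longrightarrow> odd (k + j) \<Longrightarrow> X (Suc K) k j = 0"
    and "k \<le> n" "j \<le> n"
  shows "(\<lambda>K. X K k j) \<longlonglongrightarrow> 0"
proof -
  \<comment> \<open>\<open>Y\<close> is the state after the Krawtchouk step, before squaring moves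
    the entry at \<open>(k, j)\<close> to \<open>(2 * k - j, j)\<close>.\<close>
  define Y where "Y K k j = c * (\<Sum>l\<le>n. kraw n l j * X K k l)" for K k j
  define E :: "(nat \<times> nat) set" where "E = {..n} \<times> {..n}"
  \<comment> \<open>The positions whose target \<open>2 * k - j\<close> falls outside the range from
    0 to \<open>n\<close>: the entries that the recursion discards.\<close>
  define D where "D = {(k, j) \<in> E. \<not> (j \<le> 2 * k \<and> 2 * k \<le> n + j)}"
  define N where "N K = (\<Sum>(k, j)\<in>E. real (n choose j) * (cmod (X K k j))\<^sup>2)" for K
  have fin: "finite E" "D \<subseteq> E"
    by (auto simp: E_def D_def)
  have N_eq: "N K = (\<Sum>(k, j)\<in>E. real (n choose j) * (cmod (Y K k j))\<^sup>2)" for K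
    unfolding N_def E_def sum.cartesian_product[symmetric] Y_def kraw_norm[OF c] ..
  \<comment> \<open>Only even \<open>k + j\<close> contributes, and \<open>(k, j)\<close> to
    \<open>((k + j) div 2, j)\<close> maps these pairs bijectively onto
    \<open>E - D\<close>.\<close>
  have N_Suc: "N (Suc K) = (\<Sum>(k, j)\<in>E - D. real (n choose j) * (cmod (Y K k j))\<^sup>2)" for K
  proof -
    have "N (Suc K) = (\<Sum>(k, j)\<in>{(k, j) \<in> E. even (k + j)}. real (n choose j) * (cmod (X (Suc K) k j))\<^sup>2)"
      unfolding N_def
    proof (intro sum.mono_neutral_right ballI)
      fix p assume p: "p \<in> E - {(k, j) \<in> E. even (k + j)}"
      obtain k j where "p = (k, j)"
        by force
      with p show "(case p of (k, j) \<Rightarrow> real (n choose j) * (cmod (X (Suc K) k j))\<^sup>2) = 0"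
        using X_odd[of k j K] by (simp add: E_def)
    qed (use fin in auto)
    also have "\<dots> = (\<Sum>(k, j)\<in>{(k, j) \<in> E. even (k + j)}. real (n choose j) * (cmod (Y K ((k + j) div 2) j))\<^sup>2)"
      by (intro sum.cong) (auto simp: X_even Y_def E_def)
    also have "\<dots> = (\<Sum>(k, j)\<in>E - D. real (n choose j) * (cmod (Y K k j))\<^sup>2)"
      by (rule sum.reindex_bij_witness[where i = "\<lambda>(k, j). (2 * k - j, j)" and j = "\<lambda>(k, j). ((k + j) div 2, j)"])
        (auto simp: E_def D_def elim!: evenE, presburger)
    finally show ?thesis .
  qed
  \<comment> \<open>The loss of norm in one step is exactly the mass on \<open>D\<close>; as
    \<open>N\<close> decreases and is bounded below, this mass tends to 0.\<close>
  have diff: "N K - N (Suc K) = (\<Sum>(k, j)\<in>D. real (n choose j) * (cmod (Y K k j))\<^sup>2)" for K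
    unfolding N_Suc N_eq[of K] using sum.subset_diff[OF fin(2,1)] by (metis (no_types, lifting) add_diff_cancel_left')
  have "N (Suc K) \<le> N K" for K
  proof -
    have "0 \<le> N K - N (Suc K)"
      unfolding diff by (intro sum_nonneg) auto
    then show ?thesis by simp
  qed
  then have dec: "decseq N"
    by (rule decseq_SucI)
  have "0 \<le> N K" for K
    unfolding N_def by (intro sum_nonneg) auto
  then obtain L where L: "N \<longlonglongrightarrow> L"
    using decseq_convergent[OF dec, of 0] by blast
  have N_diff_lim: "(\<lambda>K. N K - N (Suc K)) \<longlonglongrightarrow> 0"
    using tendsto_diff[OF L LIMSEQ_Suc[OF L]] by simp
  have Y_D: "(\<lambda>K. Y K k j) \<longlonglongrightarrow> 0" if "(k, j) \<in> D" for k j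
  proof -
    have "j \<le> n"
      using that by (auto simp: D_def E_def)
    then have ge1: "1 \<le> real (n choose j)"
      by (simp add: Suc_le_eq)
    have "(cmod (Y K k j))\<^sup>2 \<le> N K - N (Suc K)" for K
    proof -
      have "(cmod (Y K k j))\<^sup>2 \<le> real (n choose j) * (cmod (Y K k j))\<^sup>2"
        using mult_right_mono[OF ge1, of "(cmod (Y K k j))\<^sup>2"] by simp
      also have "\<dots> \<le> N K - N (Suc K)"
        unfolding diff using member_le_sum[of "(k, j)" D "\<lambda>(k, j). real (n choose j) * (cmod (Y K k j))\<^sup>2"] that
          finite_subset[OF fin(2,1)] by auto
      finally show ?thesis .
    qed
    then have "(\<lambda>K. (cmod (Y K k j))\<^sup>2) \<longlonglongrightarrow> 0"
      by (intro tendsto_sandwich[OF _ _ tendsto_const N_diff_lim]) auto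
    then have "(\<lambda>K. sqrt ((cmod (Y K k j))\<^sup>2)) \<longlonglongrightarrow> sqrt 0"
      by (rule tendsto_real_sqrt)
    then show ?thesis
      by (simp add: tendsto_norm_zero_iff)
  qed
  have c0: "c \<noteq> 0"
    using c n by auto
  show ?thesis
    using \<open>k \<le> n\<close> \<open>j \<le> n\<close>
  proof (induction k arbitrary: j rule: less_induct)
    case (less m)
    have Y_less: "(\<lambda>K. Y K k j) \<longlonglongrightarrow> 0" if "k < m" for k j
      unfolding Y_def using less.IH[OF that] less.prems that
      by (intro tendsto_mult_right_zero tendsto_null_sum) auto
    \<comment> \<open>For \<open>j < m\<close> the source row \<open>(m + j) div 2\<close> is below
      \<open>m\<close>, so the induction hypothesis applies.\<close>
    have X_low: "(\<lambda>K. X K m j) \<longlonglongrightarrow> 0" if "j < m" for j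
    proof (rule LIMSEQ_imp_Suc)
      show "(\<lambda>K. X (Suc K) m j) \<longlonglongrightarrow> 0"
      proof (cases "even (m + j)")
        case True
        then have "(\<lambda>K. X (Suc K) m j) = (\<lambda>K. Y K ((m + j) div 2) j)"
          using that less.prems by (simp add: X_even Y_def)
        then show ?thesis
          using that Y_less[of "(m + j) div 2" j] by simp
      qed (use that less.prems in \<open>auto simp: X_odd\<close>)
    qed
    \<comment> \<open>For \<open>m < j\<close> the entry either moves to row
      \<open>2 * m - j\<close>, which is below \<open>m\<close>, or lies in
      \<open>D\<close>.\<close>
    have Y_high: "(\<lambda>K. Y K m j) \<longlonglongrightarrow> 0" if "m < j" "j \<le> n" for j
    proof (cases "j \<le> 2 * m")
      case True
      then have "(\<lambda>K. X K (2 * m - j) j) \<longlonglongrightarrow> 0"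
        using that less.prems by (intro less.IH) auto
      from LIMSEQ_Suc[OF this] show ?thesis
        using True that less.prems by (simp add: X_even Y_def)
    next
      case False
      then show ?thesis
        using that less.prems by (intro Y_D) (auto simp: D_def E_def)
    qed
    show ?case
    proof (cases "m < n")
      case True
      have X_Suc: "(\<lambda>K. X K m (Suc m)) \<longlonglongrightarrow> 0"
        by (rule LIMSEQ_imp_Suc) (use True in \<open>simp add: X_odd\<close>)
      \<comment> \<open>\<open>Y\<close> sums over the first index of \<open>kraw\<close>, but
        \<open>kraw_tendsto_0\<close> over the second; by \<open>kraw_sym\<close> the binomial
        weight transposes the matrix.\<close>
      define Z where "Z K j = of_nat (n choose j) * Y K m j" for K j
      have Z_sum: "(\<Sum>j\<le>n. kraw n l j * Z K j) = 2 ^ n * c * of_nat (n choose l) * X K m l" if "l \<le> n" for l K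
      proof -
        have "(\<Sum>j\<le>n. kraw n l j * Z K j) = (\<Sum>j\<le>n. (of_nat (n choose j) * kraw n l j) * Y K m j)"
          by (simp add: Z_def mult_ac)
        also have "\<dots> = (\<Sum>j\<le>n. (of_nat (n choose l) * kraw n j l) * Y K m j)"
          using that by (intro sum.cong refl) (subst kraw_sym, auto)
        also have "\<dots> = of_nat (n choose l) * c * (\<Sum>i\<le>n. (\<Sum>j\<le>n. kraw n i j * kraw n j l) * X K m i)"
          unfolding Y_def sum_distrib_left sum_distrib_right
          by (subst sum.swap) (simp add: mult_ac)
        also have "(\<Sum>i\<le>n. (\<Sum>j\<le>n. kraw n i j * kraw n j l) * X K m i) = (\<Sum>i\<le>n. (if i = l then 2 ^ n else 0) * X K m i)"
          using that by (intro sum.cong refl) (subst kraw_involution, auto)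
        also have "\<dots> = 2 ^ n * X K m l"
          using that by (simp add: if_distrib[of "\<lambda>x. x * _"] cong: if_cong)
        finally show ?thesis
          by (simp add: mult_ac)
      qed
      have Z_lim: "(\<lambda>K. Z K i) \<longlonglongrightarrow> 0" if "i \<le> n" for i
      proof (rule kraw_tendsto_0[OF True _ _ that])
        show "(\<lambda>K. Z K j) \<longlonglongrightarrow> 0" if "m < j" "j \<le> n" for j
          unfolding Z_def by (intro tendsto_mult_right_zero Y_high that)
        show "(\<lambda>K. \<Sum>j\<le>n. kraw n l j * Z K j) \<longlonglongrightarrow> 0" if "l < m \<or> l = Suc m" for l
        proof -
          have "l \<le> n"
            using that True by auto
          then show ?thesis
            using that X_low X_Suc by (auto simp: Z_sum intro!: tendsto_mult_right_zero)
        qed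
      qed
      have "(\<lambda>K. (\<Sum>i\<le>n. kraw n j i * Z K i) / (2 ^ n * c * of_nat (n choose j))) \<longlonglongrightarrow> 0"
        by (intro tendsto_divide_zero tendsto_null_sum tendsto_mult_right_zero Z_lim) auto
      then show ?thesis
        using less.prems c0 by (simp add: Z_sum)
    next
      case False
      then have [simp]: "m = n"
        using less.prems by simp
      \<comment> \<open>Position \<open>(n, 0)\<close> is in \<open>D\<close> because
        \<open>2 * n\<close> exceeds \<open>n\<close>. As \<open>kraw n n 0 = 1\<close>, the value
        of \<open>Y K n 0\<close> determines \<open>X K n n\<close> from the entries with
        \<open>l < n\<close>.\<close>
      have "(\<lambda>K. Y K n 0) \<longlonglongrightarrow> 0"
        using n by (intro Y_D) (auto simp: D_def E_def)
      then have *: "(\<lambda>K. Y K n 0 / c - (\<Sum>l<n. kraw n l 0 * X K n l)) \<longlonglongrightarrow> 0 / c - 0"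
        using X_low c by (intro tendsto_intros tendsto_null_sum tendsto_mult_right_zero) auto
      have "kraw n n 0 = 1"
        by (simp add: kraw_def coeff_linear_power)
      then have "(\<lambda>K. Y K n 0 / c - (\<Sum>l<n. kraw n l 0 * X K n l)) = (\<lambda>K. X K n n)"
        using c0 by (auto simp: Y_def simp flip: lessThan_Suc_atMost)
      then have "(\<lambda>K. X K n n) \<longlonglongrightarrow> 0"
        using * by simp
      then show ?thesis
        using X_low[of j] less.prems by (cases "j = n") auto
    qed
  qed
qed

section \<open>Moments of the walk\<close>

text \<open>Put u = 2 t. The new integrand on [0, 2] is multiplied by (-1)^e when u grows by 1, so
  its two halves agree for even \<open>e\<close> and cancel for odd \<open>e\<close>.\<close>

lemma integral_doubling:
  fixes \<phi> :: "real \<Rightarrow> complex"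
  assumes cont: "continuous_on UNIV \<phi>" and per: "\<And>t. \<phi> (t + 1) = \<phi> t"
  shows "integral {0..1} (\<lambda>t. cis (2 * pi * of_int e * t) * \<phi> (2 * t)) =
    (if even e then integral {0..1} (\<lambda>t. cis (2 * pi * of_int (e div 2) * t) * \<phi> t) else 0)"
proof -
  define f where "f t = cis (pi * of_int e * t) * \<phi> t" for t
  have f_cont: "continuous_on A f" for A
    unfolding f_def by (intro continuous_intros continuous_on_subset[OF cont]) auto
  have f_int: "f integrable_on {a..b}" for a b
    by (intro integrable_continuous_interval f_cont)
  have f_shift: "f (t + 1) = cis (pi * of_int e) * f t" for t
    by (simp add: f_def per cis_mult[symmetric] ring_distribs)
  have "((\<lambda>t. f (2 *\<^sub>R t + 0)) has_integral (integral (cbox 0 2) f /\<^sub>R 2 ^ DIM(real))) (cbox ((0 - 0) /\<^sub>R 2) ((2 - 0) /\<^sub>R 2))"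
    by (rule has_integral_affinity'[OF integrable_integral]) (use f_int in auto)
  then have "integral {0..1} (\<lambda>t. f (2 * t)) = integral {0..2} f / 2"
    by (auto simp: scaleR_conv_of_real field_simps dest!: integral_unique)
  also have "integral {0..2} f = integral {0..1} f + integral {1..2} f"
    by (rule Henstock_Kurzweil_Integration.integral_combine[symmetric]) (auto simp: f_int)
  also have "integral {1..2} f = integral {0..1} (f \<circ> (\<lambda>t. t + 1))"
    using integral_shift[of 0 1 1 f] f_cont by simp
  also have "\<dots> = cis (pi * of_int e) * integral {0..1} f"
    by (simp add: o_def f_shift)
  also have "cis (pi * of_int e) = (if even e then 1 else -1)"
    by (auto simp: complex_eq_iff elim!: evenE oddE simp: ring_distribs mult.left_commute cos_int_2pin sin_int_2pin)
  finally show ?thesis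
    by (auto simp: f_def mult_ac elim!: evenE)
qed

section \<open>Continuity of the walk and its one-step structure\<close>

lemma continuous_on_matrix_mult:
  fixes f :: "'a::topological_space \<Rightarrow> complex ^ 'n ^ 'm" and g :: "'a \<Rightarrow> complex ^ 'k ^ 'n"
  assumes "continuous_on A f" "continuous_on A g"
  shows "continuous_on A (\<lambda>x. f x ** g x)"
  unfolding matrix_matrix_mult_def
  by (intro continuous_on_vec_lambda continuous_intros continuous_on_component assms)

lemma continuous_on_vector_matrix_mult:
  fixes g :: "'a::topological_space \<Rightarrow> complex ^ 'n ^ 'm"
  assumes "continuous_on A g"
  shows "continuous_on A (\<lambda>x. v v* g x)"
  unfolding vector_matrix_mult_def
  by (intro continuous_on_vec_lambda continuous_intros continuous_on_component assms)

lemma continuous_on_gmat: "continuous_on (- {0}) gmat"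
proof -
  have "continuous_on (- {0}) (\<lambda>z. gmat z $ i $ j)" for i j
    unfolding gmat_def mat2_def by (cases "i = 1"; cases "j = 1") (auto intro!: continuous_intros)
  then have "continuous_on (- {0}) (\<lambda>z. \<chi> i j. gmat z $ i $ j)"
    by (intro continuous_on_vec_lambda)
  then show ?thesis
    by simp
qed

lemma continuous_on_gprod: "continuous_on (- {0}) (gprod k)"
proof (induction k)
  case (Suc k)
  have "continuous_on (- {0}) (\<lambda>z. gmat (z ^ 2 ^ Suc k))"
    by (rule continuous_on_compose2[OF continuous_on_gmat]) (auto intro!: continuous_intros)
  then show ?case
    using Suc by (auto intro!: continuous_on_matrix_mult)
qed (simp add: continuous_on_gmat)

text \<open>The definition adds the newest factor on the left. Splitting off the first factor on the
  right leaves a product that depends on z^2 only, the form on which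
  \<open>integral_doubling\<close> acts.\<close>

lemma gprod_Suc_right: "gprod (Suc k) z = gprod k (z\<^sup>2) ** gmat z"
proof (induction k)
  case (Suc k)
  have "gprod (Suc (Suc k)) z = gmat (z ^ 2 ^ Suc (Suc k)) ** (gprod k (z\<^sup>2) ** gmat z)"
    by (simp only: gprod.simps(2)[of "Suc k"] Suc)
  also have "z ^ 2 ^ Suc (Suc k) = (z\<^sup>2) ^ 2 ^ Suc k"
    by (simp flip: power_mult)
  finally show ?case
    by (simp only: gprod.simps(2)[of k "z\<^sup>2"] matrix_mul_assoc)
qed simp

lemma vector_matrix_mult_gmat:
  "(r v* gmat z) $ 1 = \<i> / sqrt 2 * (inverse z * (r $ 1 + r $ 2))"
  "(r v* gmat z) $ 2 = \<i> / sqrt 2 * (z * (r $ 1 - r $ 2))"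
  by (simp_all add: vector_matrix_mult_def gmat_def mat2_def sum_2 algebra_simps)

text \<open>A Fourier coefficient, with the convention E[z^e ...], of a monomial of degree
  \<open>n\<close> in the row x^T G_K(z).\<close>

definition walk_moment :: "complex ^ 2 \<Rightarrow> nat \<Rightarrow> nat \<Rightarrow> int \<Rightarrow> nat \<Rightarrow> complex" where
  "walk_moment x n K e j = integral {0..1} (\<lambda>t. cis (2 * pi * of_int e * t) *
     ((x v* gprod K (cis (2 * pi * t))) $ 1 ^ j * (x v* gprod K (cis (2 * pi * t))) $ 2 ^ (n - j)))"

lemma continuous_on_row:
  "continuous_on A (\<lambda>t. (x v* gprod K (cis (2 * pi * t))) $ i)"
proof -
  have "continuous_on A (\<lambda>t. gprod K (cis (2 * pi * t)))"
    by (rule continuous_on_compose2[OF continuous_on_gprod]) (auto intro!: continuous_intros)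
  then show ?thesis
    by (intro continuous_on_component continuous_on_vector_matrix_mult)
qed

text \<open>With s = i / sqrt 2, the factor g(z) turns the row r at z^2 into (s z^(-1) (r_1 + r_2),
  s z (r_1 - r_2)). The monomial contributes z^(n - 2 j), the brackets expand through
  \<open>kraw\<close>, and \<open>integral_doubling\<close> halves the frequency e + n - 2
  j.\<close>

lemma walk_moment_Suc:
  assumes "j \<le> n"
  shows "walk_moment x n (Suc K) e j =
    (if even (e + int n) then (\<i> / sqrt 2) ^ n *
       (\<Sum>l\<le>n. kraw n l j * walk_moment x n K ((e + int n) div 2 - int j) l) else 0)"
proof -
  define r where "r t i = (x v* gprod K (cis (2 * pi * t))) $ i" for t i
  define \<phi> where "\<phi> t = (r t 1 + r t 2) ^ j * (r t 1 - r t 2) ^ (n - j)" for t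
  have r_per: "r (t + 1) i = r t i" for t i
    by (simp add: r_def ring_distribs flip: cis_mult)
  have r_cont [continuous_intros]: "continuous_on A (\<lambda>t. r t i)" for A i
    unfolding r_def by (rule continuous_on_row)
  have \<phi>_cont: "continuous_on UNIV \<phi>"
    unfolding \<phi>_def by (intro continuous_intros)
  have integrand: "cis (2 * pi * of_int e * t) *
     ((x v* gprod (Suc K) (cis (2 * pi * t))) $ 1 ^ j * (x v* gprod (Suc K) (cis (2 * pi * t))) $ 2 ^ (n - j)) =
     (\<i> / sqrt 2) ^ n * (cis (2 * pi * of_int (e + int n - 2 * int j) * t) * \<phi> (2 * t))" for t
  proof -
    let ?z = "cis (2 * pi * t)" and ?s = "\<i> / complex_of_real (sqrt 2)"
    have "?z\<^sup>2 = cis (2 * pi * (2 * t))"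
      by (simp add: Complex.DeMoivre)
    then have "x v* gprod (Suc K) ?z = (x v* gprod K (cis (2 * pi * (2 * t)))) v* gmat ?z"
      by (simp only: gprod_Suc_right vector_matrix_mul_assoc)
    then have "cis (2 * pi * of_int e * t) *
       ((x v* gprod (Suc K) ?z) $ 1 ^ j * (x v* gprod (Suc K) ?z) $ 2 ^ (n - j)) =
       cis (2 * pi * of_int e * t) * ((?s * (inverse ?z * (r (2 * t) 1 + r (2 * t) 2))) ^ j *
         (?s * (?z * (r (2 * t) 1 - r (2 * t) 2))) ^ (n - j))"
      by (simp only: vector_matrix_mult_gmat r_def)
    also have "\<dots> = (?s ^ j * ?s ^ (n - j)) * ((cis (2 * pi * of_int e * t) * inverse ?z ^ j * ?z ^ (n - j)) * \<phi> (2 * t))"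
      by (simp only: power_mult_distrib \<phi>_def mult_ac)
    also have "?s ^ j * ?s ^ (n - j) = ?s ^ n"
      using assms by (simp flip: power_add)
    also have "cis (2 * pi * of_int e * t) * inverse ?z ^ j * ?z ^ (n - j) = cis (2 * pi * of_int (e + int n - 2 * int j) * t)"
      using assms by (simp add: Complex.DeMoivre cis_mult of_nat_diff algebra_simps)
    finally show ?thesis .
  qed
  have "walk_moment x n (Suc K) e j = (\<i> / sqrt 2) ^ n *
      integral {0..1} (\<lambda>t. cis (2 * pi * of_int (e + int n - 2 * int j) * t) * \<phi> (2 * t))"
    unfolding walk_moment_def integrand by simp
  also have "\<dots> = (\<i> / sqrt 2) ^ n *
      (if even (e + int n - 2 * int j) then integral {0..1} (\<lambda>t. cis (2 * pi * of_int ((e + int n - 2 * int j) div 2) * t) * \<phi> t) else 0)"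
    by (subst integral_doubling[OF \<phi>_cont]) (simp_all add: \<phi>_def r_per)
  also have "integral {0..1} (\<lambda>t. cis (2 * pi * of_int e' * t) * \<phi> t) = (\<Sum>l\<le>n. kraw n l j * walk_moment x n K e' l)" for e'
  proof -
    have "integral {0..1} (\<lambda>t. cis (2 * pi * of_int e' * t) * \<phi> t) =
        integral {0..1} (\<lambda>t. \<Sum>l\<le>n. kraw n l j * (cis (2 * pi * of_int e' * t) * (r t 1 ^ l * r t 2 ^ (n - l))))"
      unfolding \<phi>_def kraw_expansion[OF assms] sum_distrib_left by (simp add: mult_ac)
    also have "\<dots> = (\<Sum>l\<le>n. integral {0..1} (\<lambda>t. kraw n l j * (cis (2 * pi * of_int e' * t) * (r t 1 ^ l * r t 2 ^ (n - l)))))"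
      by (intro integral_sum integrable_continuous_interval continuous_intros) auto
    finally show ?thesis
      by (simp add: walk_moment_def r_def)
  qed
  also have "(e + int n - 2 * int j) div 2 = (e + int n) div 2 - int j"
    by presburger
  also have "even (e + int n - 2 * int j) = even (e + int n)"
    by simp
  finally show ?thesis
    by (simp only: if_distrib[of "\<lambda>y. _ * y"] mult_zero_right)
qed

lemma walk_moment_0_tendsto_0:
  assumes n: "0 < n" and j: "j \<le> n"
  shows "(\<lambda>K. walk_moment x n K 0 j) \<longlonglongrightarrow> 0"
proof (cases "even n")
  case False
  show ?thesis
    by (rule LIMSEQ_imp_Suc) (use False j in \<open>simp add: walk_moment_Suc\<close>)
next
  case True
  \<comment> \<open>For even \<open>n\<close>, frequency 0 is \<open>k = n div 2\<close>. With
    \<open>Suc K\<close> in place of \<open>K\<close>, \<open>walk_moment_Suc\<close> makes every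
    moment with \<open>e + int n\<close> odd vanish, which yields the condition for odd
    \<open>k + j\<close>.\<close>
  define X where "X K k = walk_moment x n (Suc K) (int n - 2 * int k)" for K k
  have "(\<lambda>K. X K (n div 2) j) \<longlonglongrightarrow> 0"
  proof (rule kraw_recursion_tendsto_0[OF n, where c = "(\<i> / sqrt 2) ^ n"])
    show "(cmod ((\<i> / complex_of_real (sqrt 2)) ^ n))\<^sup>2 * 2 ^ n = 1"
      by (simp add: norm_power norm_divide power_divide flip: power_mult power2_eq_square)
        (simp add: power_mult mult.commute[of n])
    fix K k j assume kj: "k \<le> n" "j \<le> n"
    have *: "X (Suc K) k j = (\<i> / sqrt 2) ^ n * (\<Sum>l\<le>n. kraw n l j * walk_moment x n (Suc K) (int n - int k - int j) l)"
      unfolding X_def by (subst walk_moment_Suc) (use kj in auto)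
    show "X (Suc K) k j = (\<i> / sqrt 2) ^ n * (\<Sum>l\<le>n. kraw n l j * X K ((k + j) div 2) l)" if "even (k + j)"
    proof -
      have "int n - int k - int j = int n - 2 * int ((k + j) div 2)"
        using that by presburger
      then show ?thesis
        using * by (simp only: X_def)
    qed
    show "X (Suc K) k j = 0" if "odd (k + j)"
    proof -
      have "odd (int n - int k - int j + int n)"
        using that by presburger
      then show ?thesis
        unfolding * by (simp add: walk_moment_Suc)
    qed
  qed (use j in auto)
  moreover have "int n - 2 * int (n div 2) = 0"
    using True by presburger
  ultimately have "(\<lambda>K. walk_moment x n (Suc K) 0 j) \<longlonglongrightarrow> 0"
    by (simp only: X_def)
  then show ?thesis
    by (rule LIMSEQ_imp_Suc)
qed

definition bil :: "complex ^ 2 \<Rightarrow> cmat2 \<Rightarrow> complex ^ 2 \<Rightarrow> complex" where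
  "bil x A y = (x v* A) $ 1 * y $ 1 + (x v* A) $ 2 * y $ 2"

text \<open>By the binomial theorem the power is a fixed combination of monomials in the row, so
  only moments of frequency 0 occur.\<close>

lemma integral_bil_gprod_tendsto_0:
  assumes "0 < n"
  shows "(\<lambda>K. integral {0..1} (\<lambda>t. bil x (gprod K (cis (2 * pi * t))) y ^ n)) \<longlonglongrightarrow> 0"
proof -
  have "integral {0..1} (\<lambda>t. bil x (gprod K (cis (2 * pi * t))) y ^ n) =
      (\<Sum>j\<le>n. of_nat (n choose j) * y $ 1 ^ j * y $ 2 ^ (n - j) * walk_moment x n K 0 j)" for K
  proof -
    have "integral {0..1} (\<lambda>t. bil x (gprod K (cis (2 * pi * t))) y ^ n) =
        integral {0..1} (\<lambda>t. \<Sum>j\<le>n. (of_nat (n choose j) * y $ 1 ^ j * y $ 2 ^ (n - j)) *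
          ((x v* gprod K (cis (2 * pi * t))) $ 1 ^ j * (x v* gprod K (cis (2 * pi * t))) $ 2 ^ (n - j)))"
      unfolding bil_def binomial_ring by (simp add: power_mult_distrib mult_ac)
    also have "\<dots> = (\<Sum>j\<le>n. integral {0..1} (\<lambda>t. (of_nat (n choose j) * y $ 1 ^ j * y $ 2 ^ (n - j)) *
          ((x v* gprod K (cis (2 * pi * t))) $ 1 ^ j * (x v* gprod K (cis (2 * pi * t))) $ 2 ^ (n - j))))"
      by (intro integral_sum integrable_continuous_interval continuous_intros continuous_on_row) auto
    finally show ?thesis
      by (simp add: walk_moment_def)
  qed
  then show ?thesis
    using assms by (auto intro!: tendsto_null_sum tendsto_mult_right_zero walk_moment_0_tendsto_0)
qed

section \<open>Polynomial functions on SU(2)\<close>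

text \<open>For |p|^2 + |q|^2 = 1 this is the unit quaternion p + q j.\<close>

definition su2 :: "complex \<Rightarrow> complex \<Rightarrow> cmat2" where
  "su2 p q = mat2 p q (- cnj q) (cnj p)"

lemma mat2_nth [simp]:
  "mat2 a b c d $ 1 $ 1 = a" "mat2 a b c d $ 1 $ 2 = b"
  "mat2 a b c d $ 2 $ 1 = c" "mat2 a b c d $ 2 $ 2 = d"
  by (simp_all add: mat2_def)

lemma cmat2_eq_iff:
  "A = B \<longleftrightarrow> A $ 1 $ 1 = B $ 1 $ 1 \<and> A $ 1 $ 2 = B $ 1 $ 2 \<and> A $ 2 $ 1 = B $ 2 $ 1 \<and> A $ 2 $ 2 = B $ 2 $ 2"
  for A B :: cmat2
  by (auto simp: vec_eq_iff forall_2)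

lemma su2_mem_SU2_iff: "su2 p q \<in> SU2 \<longleftrightarrow> (cmod p)\<^sup>2 + (cmod q)\<^sup>2 = 1"
proof -
  have "su2 p q \<in> SU2 \<longleftrightarrow> p * cnj p + q * cnj q = 1"
    by (auto simp: SU2_def cmat2_eq_iff matrix_matrix_mult_def adjoint2_def mat_def su2_def sum_2 det_2 mult.commute add.commute)
  also have "p * cnj p + q * cnj q = complex_of_real ((cmod p)\<^sup>2 + (cmod q)\<^sup>2)"
    by (simp only: of_real_add complex_norm_square)
  also have "\<dots> = 1 \<longleftrightarrow> (cmod p)\<^sup>2 + (cmod q)\<^sup>2 = 1"
    by (rule of_real_eq_1_iff)
  finally show ?thesis .
qed

lemma SU2_eq_su2:
  assumes "A \<in> SU2"
  shows "A = su2 (A $ 1 $ 1) (A $ 1 $ 2)"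
proof -
  obtain a b c d where A: "A = mat2 a b c d"
    using that[of "A $ 1 $ 1" "A $ 1 $ 2" "A $ 2 $ 1" "A $ 2 $ 2"] by (simp add: cmat2_eq_iff)
  have eqs: "a * cnj a + b * cnj b = 1" "c * cnj a + d * cnj b = 0" "a * d - b * c = 1"
    using assms unfolding A
    by (auto simp: SU2_def cmat2_eq_iff matrix_matrix_mult_def adjoint2_def mat_def sum_2 det_2)
  \<comment> \<open>Multiplying by |a|^2 + |b|^2 = 1 and regrouping leaves the determinant and the
    orthogonality relation of the rows; \<open>c\<close> is treated in the same way.\<close>
  have "d = d * (a * cnj a + b * cnj b)"
    by (simp add: eqs)
  also have "\<dots> = cnj a * (a * d - b * c) + b * (c * cnj a + d * cnj b)"
    by (simp add: algebra_simps)
  finally have d: "d = cnj a"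
    by (simp add: eqs)
  have "c = c * (a * cnj a + b * cnj b)"
    by (simp add: eqs)
  also have "\<dots> = a * (c * cnj a + d * cnj b) - cnj b * (a * d - b * c)"
    by (simp add: algebra_simps)
  finally have "c = - cnj b"
    by (simp add: eqs)
  with d show ?thesis
    by (simp add: A su2_def)
qed

lemma SU2_mult:
  assumes "A \<in> SU2" "B \<in> SU2"
  shows "A ** B \<in> SU2"
proof -
  have "(A ** B) ** adjoint2 (A ** B) = A ** (B ** adjoint2 B) ** adjoint2 A"
    by (simp add: cmat2_eq_iff matrix_matrix_mult_def adjoint2_def sum_2 algebra_simps)
  then show ?thesis
    using assms by (simp add: SU2_def det_mul)
qed

lemma gprod_mem_SU2:
  assumes "cmod z = 1"
  shows "gprod k z \<in> SU2"
proof -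
  have g: "gmat z \<in> SU2" if "cmod z = 1" for z
  proof -
    have "z * cnj z = 1"
      using that by (simp flip: complex_norm_square)
    then have "inverse z = cnj z"
      by (rule inverse_unique)
    then have "gmat z = su2 (\<i> * cnj z / sqrt 2) (\<i> * z / sqrt 2)"
      by (simp add: gmat_def su2_def)
    then show ?thesis
      using that by (simp add: su2_mem_SU2_iff norm_mult norm_divide power_divide)
  qed
  show ?thesis
    by (induction k) (use assms in \<open>auto intro!: SU2_mult g simp: norm_power\<close>)
qed

lemma continuous_on_su2:
  assumes "continuous_on S f" "continuous_on S g"
  shows "continuous_on S (\<lambda>x. su2 (f x) (g x))"
proof -
  have "continuous_on S (\<lambda>x. su2 (f x) (g x) $ i $ j)" for i j
    unfolding su2_def mat2_def using assms
    by (cases "i = 1"; cases "j = 1") (auto intro!: continuous_intros)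
  then have "continuous_on S (\<lambda>x. \<chi> i j. su2 (f x) (g x) $ i $ j)"
    by (intro continuous_on_vec_lambda)
  then show ?thesis
    by simp
qed

lemma compact_SU2: "compact SU2"
proof -
  have "SU2 = (\<lambda>(p, q). su2 p q) ` sphere 0 1"
  proof (intro equalityI subsetI)
    fix A assume A: "A \<in> SU2"
    then have "su2 (A $ 1 $ 1) (A $ 1 $ 2) \<in> SU2"
      using SU2_eq_su2 by simp
    then have "(A $ 1 $ 1, A $ 1 $ 2) \<in> sphere 0 1"
      by (simp add: su2_mem_SU2_iff norm_Pair)
    then show "A \<in> (\<lambda>(p, q). su2 p q) ` sphere 0 1"
      using SU2_eq_su2[OF A] by (force intro: image_eqI)
  qed (auto simp: su2_mem_SU2_iff norm_Pair)
  moreover have "compact ((\<lambda>(p, q). su2 p q) ` sphere 0 1)"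
    unfolding case_prod_unfold by (intro compact_continuous_image continuous_on_su2 continuous_intros compact_sphere)
  ultimately show ?thesis
    by simp
qed

section \<open>Matrix coefficients and the span of their powers\<close>

lemma bil_add_scale:
  "bil (x + s *s u) A y = bil x A y + s * bil u A y"
  "bil x A (y + s *s v) = bil x A y + s * bil x A v"
  by (simp_all add: bil_def vector_matrix_mult_def sum_2 algebra_simps)

text \<open>Multiplicativity of the determinant for the 2 x 2 matrix of values of \<open>bil\<close>
  at the rows \<open>x\<close>, \<open>u\<close> and the columns \<open>y\<close>,
  \<open>v\<close>.\<close>

lemma bil_det:
  "bil x A y * bil u A v - bil u A y * bil x A v =
    (x $ 1 * u $ 2 - x $ 2 * u $ 1) * (y $ 1 * v $ 2 - y $ 2 * v $ 1) * det A"
  by (simp add: bil_def vector_matrix_mult_def sum_2 det_2 algebra_simps)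

lemma bil_axis: "bil (axis i 1) A (axis j 1) = A $ i $ j"
  using exhaust_2[of i] exhaust_2[of j] by (auto simp: bil_def vector_matrix_mult_def sum_2 axis_def)

text \<open>The scalar in \<open>power\<close> makes this a complex vector space, and
  \<open>n = 0\<close> supplies the constants. The generators are functions whose averages are
  accessible both for the walk and for Haar measure.\<close>

inductive bil_span :: "(cmat2 \<Rightarrow> complex) \<Rightarrow> bool" where
  power: "bil_span (\<lambda>A. c * bil x A y ^ n)"
| add: "bil_span f \<Longrightarrow> bil_span g \<Longrightarrow> bil_span (\<lambda>A. f A + g A)"

lemma bil_span_scale: "bil_span f \<Longrightarrow> bil_span (\<lambda>A. c * f A)"
  by (induction rule: bil_span.induct) (auto simp: ring_distribs simp flip: mult.assoc intro: bil_span.intros)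

lemma bil_span_diff: "bil_span f \<Longrightarrow> bil_span g \<Longrightarrow> bil_span (\<lambda>A. f A - g A)"
  using bil_span.add[of f "\<lambda>A. (-1) * g A"] bil_span_scale[of g "-1"] by simp

lemma bil_span_const: "bil_span (\<lambda>A. c)"
  using bil_span.power[of c 0 0 0] by simp

lemma bil_span_sum: "(\<And>i. i \<in> I \<Longrightarrow> bil_span (f i)) \<Longrightarrow> bil_span (\<lambda>A. \<Sum>i\<in>I. f i A)"
  by (induction I rule: infinite_finite_induct) (auto intro: bil_span.add bil_span_const)

text \<open>Replacing \<open>p(s)\<close> by \<open>p(2 s) - 2^N p(s)\<close> kills the top coefficient and rescales the others.\<close>

lemma bil_span_coeff:
  assumes "\<And>s. bil_span (\<lambda>A. poly (p A) s)" "\<And>A. degree (p A) \<le> N"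
  shows "bil_span (\<lambda>A. coeff (p A) l)"
  using assms
proof (induction N arbitrary: p l)
  case 0
  show ?case
  proof (cases "l = 0")
    case True
    then show ?thesis
      using 0(1)[of 0] by (simp add: poly_0_coeff_0)
  next
    case False
    then show ?thesis
      using 0(2) bil_span_const[of 0] by (simp add: coeff_eq_0)
  qed
next
  case (Suc N)
  define q where "q A = pcompose (p A) [:0, 2:] - smult (2 ^ Suc N) (p A)" for A
  have coeff_q: "coeff (q A) l = (2 ^ l - 2 ^ Suc N) * coeff (p A) l" for A l
    by (simp add: q_def coeff_pcompose_linear algebra_simps)
  have span_q: "bil_span (\<lambda>A. coeff (q A) l)" for l
  proof (rule Suc.IH)
    show "bil_span (\<lambda>A. poly (q A) s)" for s
      unfolding q_def using Suc.prems(1)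
      by (auto simp: poly_pcompose intro!: bil_span_diff bil_span_scale simp del: power_Suc)
    show "degree (q A) \<le> N" for A
    proof (rule degree_le, intro allI impI)
      fix i assume "N < i"
      then show "coeff (q A) i = 0"
        using Suc.prems(2)[of A] by (cases "i = Suc N") (auto simp: coeff_q coeff_eq_0)
    qed
  qed
  have low: "bil_span (\<lambda>A. coeff (p A) l)" if "l \<le> N" for l
  proof -
    have "(2 ^ l :: nat) \<noteq> 2 ^ Suc N"
      using that by (subst power_inject_exp) auto
    then have "(2 ^ l :: complex) \<noteq> 2 ^ Suc N"
      by (metis of_nat_eq_iff of_nat_numeral of_nat_power)
    then show ?thesis
      using bil_span_scale[OF span_q[of l], of "1 / (2 ^ l - 2 ^ Suc N)"] by (simp add: coeff_q)
  qed
  consider "l \<le> N" | "l = Suc N" | "Suc N < l"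
    by linarith
  then show ?case
  proof cases
    case 2
    \<comment> \<open>The top coefficient is lost in \<open>q\<close>, but it is the value at 1
      minus all lower coefficients.\<close>
    have "coeff (p A) l = poly (p A) 1 - (\<Sum>i\<le>N. coeff (p A) i)" for A
    proof -
      have "poly (p A) 1 = (\<Sum>i\<le>degree (p A). coeff (p A) i)"
        by (simp add: poly_altdef)
      also have "\<dots> = (\<Sum>i\<le>Suc N. coeff (p A) i)"
        using Suc.prems(2)[of A] by (intro sum.mono_neutral_left) (auto simp: coeff_eq_0)
      finally show ?thesis
        using 2 by simp
    qed
    then show ?thesis
      using Suc.prems(1)[of 1] low by (auto intro!: bil_span_diff bil_span_sum)
  next
    case 3
    then have "coeff (p A) l = 0" for A
      using Suc.prems(2)[of A] by (intro coeff_eq_0) linarith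
    then show ?thesis
      using bil_span_const[of 0] by simp
  qed (rule low)
qed

text \<open>Agreement is asked on \<open>SU2\<close> only, since closure under products relies on
  \<open>det A = 1\<close>.\<close>

definition SU2_span :: "(cmat2 \<Rightarrow> complex) \<Rightarrow> bool" where
  "SU2_span f \<longleftrightarrow> (\<exists>g. bil_span g \<and> (\<forall>A\<in>SU2. f A = g A))"

lemma SU2_span_cong: "SU2_span g \<Longrightarrow> (\<And>A. A \<in> SU2 \<Longrightarrow> f A = g A) \<Longrightarrow> SU2_span f"
  by (auto simp: SU2_span_def)

lemma bil_span_imp_SU2_span: "bil_span f \<Longrightarrow> SU2_span f"
  by (auto simp: SU2_span_def)

lemma SU2_span_add: "SU2_span f \<Longrightarrow> SU2_span g \<Longrightarrow> SU2_span (\<lambda>A. f A + g A)"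
  unfolding SU2_span_def by (elim exE conjE) (rule exI, rule conjI, erule (1) bil_span.add, simp)

lemma SU2_span_scale: "SU2_span f \<Longrightarrow> SU2_span (\<lambda>A. c * f A)"
  unfolding SU2_span_def by (elim exE conjE) (rule exI, rule conjI, erule bil_span_scale[of _ c], simp)

text \<open>The Clebsch--Gordan rule for multiplication by the two-dimensional representation: polarizing
  \<open>bil x A y ^ Suc n\<close> in both arguments yields a combination of \<open>bil x A y ^ n * bil u A v\<close> and
  \<open>bil x A y ^ (n - 1) * bil u A y * bil x A v\<close>, and these differ by a lower power as \<open>det A = 1\<close>.\<close>

lemma SU2_span_power_mult_bil: "SU2_span (\<lambda>A. bil x A y ^ n * bil u A v)"
proof (cases n)
  case 0
  then show ?thesis
    using bil_span_imp_SU2_span[OF bil_span.power[of 1 u v 1]] by simp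
next
  case (Suc m)
  \<comment> \<open>First polarization: the linear coefficient in s after replacing \<open>x\<close>
    by \<open>x + s *s u\<close>. The column stays \<open>y + t *s v\<close> with \<open>t\<close>
    arbitrary, in preparation for the second.\<close>
  have 1: "bil_span (\<lambda>A. of_nat (Suc n) * (bil u A (y + t *s v) * bil x A (y + t *s v) ^ n))" for t
  proof -
    have "bil_span (\<lambda>A. coeff ([:bil x A (y + t *s v), bil u A (y + t *s v):] ^ Suc n) 1)"
    proof (rule bil_span_coeff[where N = "Suc n"])
      show "bil_span (\<lambda>A. poly ([:bil x A (y + t *s v), bil u A (y + t *s v):] ^ Suc n) s)" for s
        using bil_span.power[of 1 "x + s *s u" "y + t *s v" "Suc n"]
        by (simp add: bil_add_scale(1) poly_power del: power_Suc)
      show "degree ([:bil x A (y + t *s v), bil u A (y + t *s v):] ^ Suc n) \<le> Suc n" for A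
        by (rule order_trans[OF degree_power_le]) (simp add: degree_pCons_eq_if)
    qed
    then show ?thesis
      by (subst (asm) coeff_linear_poly_power) (auto simp: mult.assoc)
  qed
  \<comment> \<open>Second polarization: the previous function is a polynomial in \<open>t\<close>,
    and its linear coefficient is extracted.\<close>
  have 2: "bil_span (\<lambda>A. coeff (smult (of_nat (Suc n)) ([:bil u A y, bil u A v:] * [:bil x A y, bil x A v:] ^ n)) 1)"
  proof (rule bil_span_coeff[where N = "Suc n"])
    show "bil_span (\<lambda>A. poly (smult (of_nat (Suc n)) ([:bil u A y, bil u A v:] * [:bil x A y, bil x A v:] ^ n)) s)" for s
      using 1[of s] by (simp only: bil_add_scale(2) poly_smult poly_mult poly_power poly_pCons poly_0 mult_zero_right add_0_right)
    show "degree (smult (of_nat (Suc n)) ([:bil u A y, bil u A v:] * [:bil x A y, bil x A v:] ^ n)) \<le> Suc n" for A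
    proof -
      have "degree ([:bil x A y, bil x A v:] ^ n) \<le> n"
        by (rule order_trans[OF degree_power_le]) (simp add: degree_pCons_eq_if)
      moreover have "degree [:bil u A y, bil u A v:] \<le> 1"
        by (simp add: degree_pCons_eq_if)
      ultimately show ?thesis
        using degree_mult_le[of "[:bil u A y, bil u A v:]" "[:bil x A y, bil x A v:] ^ n"]
          degree_smult_le[of "of_nat (Suc n)" "[:bil u A y, bil u A v:] * [:bil x A y, bil x A v:] ^ n"] by linarith
    qed
  qed
  define \<delta> where "\<delta> = (x $ 1 * u $ 2 - x $ 2 * u $ 1) * (y $ 1 * v $ 2 - y $ 2 * v $ 1)"
  let ?f = "\<lambda>A. coeff (smult (of_nat (Suc n)) ([:bil u A y, bil u A v:] * [:bil x A y, bil x A v:] ^ n)) 1"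
  \<comment> \<open>Eliminating \<open>bil u A y * bil x A v\<close> through \<open>bil_det\<close>
    turns \<open>?f A\<close> into \<open>Suc n\<close> times the difference of \<open>Suc n\<close>
    copies of the wanted product and a multiple of \<open>bil x A y ^ m\<close>.\<close>
  have "bil x A y ^ n * bil u A v = 1 / of_nat (Suc n) ^ 2 * ?f A + of_nat n * \<delta> / of_nat (Suc n) * bil x A y ^ m"
    if "A \<in> SU2" for A
  proof -
    have c0: "coeff ([:bil x A y, bil x A v:] ^ n) 0 = bil x A y ^ n"
      by (subst coeff_linear_poly_power) auto
    have c1: "coeff ([:bil x A y, bil x A v:] ^ n) 1 = of_nat n * bil x A v * bil x A y ^ m"
      using Suc by (subst coeff_linear_poly_power) auto
    have det: "bil u A y * bil x A v = bil x A y * bil u A v - \<delta>"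
      using bil_det[of x A y u v] that by (simp add: SU2_def \<delta>_def algebra_simps)
    have "?f A = of_nat (Suc n) * (bil u A y * coeff ([:bil x A y, bil x A v:] ^ n) 1 + bil u A v * coeff ([:bil x A y, bil x A v:] ^ n) 0)"
      by (simp add: coeff_pCons)
    also have "\<dots> = of_nat (Suc n) * (of_nat n * (bil u A y * bil x A v) * bil x A y ^ m + bil u A v * bil x A y ^ n)"
      unfolding c0 c1 by (simp only: mult_ac)
    also have "\<dots> = of_nat (Suc n) * (of_nat (Suc n) * (bil x A y ^ n * bil u A v) - of_nat n * \<delta> * bil x A y ^ m)"
      unfolding det Suc by (simp add: algebra_simps)
    finally have f: "?f A = of_nat (Suc n) * (of_nat (Suc n) * (bil x A y ^ n * bil u A v) - of_nat n * \<delta> * bil x A y ^ m)" .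
    have "of_nat (Suc n) \<noteq> (0 :: complex)"
      by (rule of_nat_neq_0)
    then show ?thesis
      unfolding f power2_eq_square by (simp add: divide_simps del: of_nat_Suc)
  qed
  moreover have "SU2_span (\<lambda>A. 1 / of_nat (Suc n) ^ 2 * ?f A + of_nat n * \<delta> / of_nat (Suc n) * bil x A y ^ m)"
    by (intro bil_span_imp_SU2_span bil_span.add bil_span.power bil_span_scale 2)
  ultimately show ?thesis
    by (rule SU2_span_cong[rotated])
qed

lemma SU2_span_mult_bil:
  assumes "SU2_span f"
  shows "SU2_span (\<lambda>A. f A * bil u A v)"
proof -
  have "SU2_span (\<lambda>A. g A * bil u A v)" if "bil_span g" for g
    using that
  proof induction
    case (power c x y n)
    then show ?case
      using SU2_span_scale[OF SU2_span_power_mult_bil, of c] by (simp add: mult.assoc)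
  qed (auto simp: ring_distribs intro: SU2_span_add)
  moreover obtain g where "bil_span g" "\<And>A. A \<in> SU2 \<Longrightarrow> f A = g A"
    using assms by (auto simp: SU2_span_def)
  ultimately show ?thesis
    by - (rule SU2_span_cong, assumption, simp)
qed

lemma SU2_span_mult:
  assumes "SU2_span f" "SU2_span g"
  shows "SU2_span (\<lambda>A. f A * g A)"
proof -
  have pow: "SU2_span (\<lambda>A. f A * bil x A y ^ n)" for x y n
  proof (induction n)
    case (Suc n)
    then show ?case
      using SU2_span_mult_bil[OF Suc, of x y] by (simp add: mult_ac)
  qed (use assms(1) in simp)
  have "SU2_span (\<lambda>A. f A * h A)" if "bil_span h" for h
    using that
  proof induction
    case (power c x y n)
    then show ?case
      using SU2_span_scale[OF pow, of c] by (simp add: mult_ac)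
  qed (auto simp: ring_distribs intro: SU2_span_add)
  moreover obtain h where "bil_span h" "\<And>A. A \<in> SU2 \<Longrightarrow> g A = h A"
    using assms(2) by (auto simp: SU2_span_def)
  ultimately show ?thesis
    by - (rule SU2_span_cong, assumption, simp)
qed

lemma SU2_span_entry: "SU2_span (\<lambda>A. c * A $ i $ j)"
  using bil_span_imp_SU2_span[OF bil_span.power[of c "axis i 1" "axis j 1" 1]] by (simp add: bil_axis)

text \<open>The essential case is real-linear \<open>f\<close>. On \<open>SU2\<close> the second row
  consists, up to sign, of conjugates of the first, so real and imaginary parts of the entries are
  complex-linear in the entries.\<close>

lemma SU2_span_real_polynomial_function:
  fixes f :: "cmat2 \<Rightarrow> real"
  assumes "real_polynomial_function f"
  shows "SU2_span (\<lambda>A. of_real (f A))"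
  using assms
proof induction
  case (linear f)
  interpret bounded_linear f
    by fact
  \<comment> \<open>The values of \<open>f\<close> at the quaternion units 1, i, j, k, of which
    every element of \<open>SU2\<close> is a real combination.\<close>
  let ?f1 = "complex_of_real (f (su2 1 0))" and ?f2 = "complex_of_real (f (su2 \<i> 0))"
    and ?f3 = "complex_of_real (f (su2 0 1))" and ?f4 = "complex_of_real (f (su2 0 \<i>))"
  have *: "complex_of_real (f A) = ((?f1 / 2 + ?f2 / (2 * \<i>)) * A $ 1 $ 1 + (?f1 / 2 - ?f2 / (2 * \<i>)) * A $ 2 $ 2) +
    ((?f3 / 2 + ?f4 / (2 * \<i>)) * A $ 1 $ 2 + (- ?f3 / 2 + ?f4 / (2 * \<i>)) * A $ 2 $ 1)"
    if "A \<in> SU2" for A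
  proof -
    let ?a = "A $ 1 $ 1" and ?b = "A $ 1 $ 2"
    have A: "A = su2 ?a ?b"
      by (rule SU2_eq_su2[OF that])
    have "A = Re ?a *\<^sub>R su2 1 0 + Im ?a *\<^sub>R su2 \<i> 0 + Re ?b *\<^sub>R su2 0 1 + Im ?b *\<^sub>R su2 0 \<i>"
      by (subst A) (simp add: cmat2_eq_iff su2_def complex_eq_iff)
    from arg_cong[OF this, of f]
    have "f A = Re ?a * f (su2 1 0) + Im ?a * f (su2 \<i> 0) + Re ?b * f (su2 0 1) + Im ?b * f (su2 0 \<i>)"
      by (simp only: add scaleR real_scaleR_def)
    then have "complex_of_real (f A) = complex_of_real (Re ?a) * ?f1 + complex_of_real (Im ?a) * ?f2 +
        complex_of_real (Re ?b) * ?f3 + complex_of_real (Im ?b) * ?f4"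
      by (simp only: of_real_add of_real_mult)
    moreover have "A $ 2 $ 2 = cnj ?a" "A $ 2 $ 1 = - cnj ?b"
      using arg_cong[OF A, of "\<lambda>A. A $ 2 $ 2"] arg_cong[OF A, of "\<lambda>A. A $ 2 $ 1"] by (simp_all add: su2_def)
    moreover have "complex_of_real (Re w) = (w + cnj w) / 2" "complex_of_real (Im w) = (w - cnj w) / (2 * \<i>)" for w
      by (simp_all add: complex_eq_iff)
    ultimately show ?thesis
      by (simp only:) (simp add: field_simps)
  qed
  show ?case
    by (rule SU2_span_cong[OF _ *]) (intro SU2_span_add SU2_span_entry)
next
  case (const c)
  show ?case
    by (rule bil_span_imp_SU2_span[OF bil_span_const])
qed (auto intro: SU2_span_add SU2_span_mult)

section \<open>Existence of Haar measure\<close>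

text \<open>Encodes the quaternion a + b j in \<open>real ^ 4\<close>, where orthogonal maps
  preserve Lebesgue measure.\<close>

definition pair_to_vec4 :: "complex \<Rightarrow> complex \<Rightarrow> real ^ 4" where
  "pair_to_vec4 a b = (\<chi> i. if i = 1 then Re a else if i = 2 then Im a else if i = 3 then Re b else Im b)"

definition vec4_fst :: "real ^ 4 \<Rightarrow> complex" where
  "vec4_fst x = Complex (x $ 1) (x $ 2)"

definition vec4_snd :: "real ^ 4 \<Rightarrow> complex" where
  "vec4_snd x = Complex (x $ 3) (x $ 4)"

lemma vec4_simps [simp]:
  "vec4_fst (pair_to_vec4 a b) = a" "vec4_snd (pair_to_vec4 a b) = b"
  "vec4_fst (x + y) = vec4_fst x + vec4_fst y" "vec4_snd (x + y) = vec4_snd x + vec4_snd y"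
  "vec4_fst (r *\<^sub>R x) = of_real r * vec4_fst x" "vec4_snd (r *\<^sub>R x) = of_real r * vec4_snd x"
  by (simp_all add: vec4_fst_def vec4_snd_def pair_to_vec4_def complex_eq_iff)

lemma vec4_eq_iff: "x = y \<longleftrightarrow> vec4_fst x = vec4_fst y \<and> vec4_snd x = vec4_snd y"
  by (auto simp: vec_eq_iff forall_4 vec4_fst_def vec4_snd_def)

lemma norm_vec4: "(norm x)\<^sup>2 = (cmod (vec4_fst x))\<^sup>2 + (cmod (vec4_snd x))\<^sup>2"
  by (simp only: power2_norm_eq_inner) (simp add: inner_vec_def inner_complex_def sum_4 vec4_fst_def vec4_snd_def)

text \<open>Left multiplication of the quaternion a + b j by p + q j, where j z = cnj(z) j and j^2 =
  -1.\<close>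

definition quat_mult :: "complex \<Rightarrow> complex \<Rightarrow> real ^ 4 \<Rightarrow> real ^ 4" where
  "quat_mult p q x = pair_to_vec4 (p * vec4_fst x - q * cnj (vec4_snd x)) (p * vec4_snd x + q * cnj (vec4_fst x))"

lemma norm_quat_mult:
  assumes "(cmod p)\<^sup>2 + (cmod q)\<^sup>2 = 1"
  shows "norm (quat_mult p q x) = norm x"
proof -
  have "(norm (quat_mult p q x))\<^sup>2 = ((cmod p)\<^sup>2 + (cmod q)\<^sup>2) * (norm x)\<^sup>2"
    by (simp add: quat_mult_def norm_vec4 cmod_power2) (simp add: power2_eq_square algebra_simps)
  then show ?thesis
    using assms by simp
qed

lemma orthogonal_transformation_quat_mult:
  assumes "(cmod p)\<^sup>2 + (cmod q)\<^sup>2 = 1"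
  shows "orthogonal_transformation (quat_mult p q)"
proof -
  have "linear (quat_mult p q)"
    by (intro linearI) (simp_all add: vec4_eq_iff quat_mult_def algebra_simps)
  then show ?thesis
    using norm_quat_mult[OF assms] by (simp add: orthogonal_transformation)
qed

text \<open>Radial projection to the unit quaternions. At \<open>x = 0\<close> division by 0 gives
  the zero matrix, which is not in \<open>SU2\<close>.\<close>

definition vec4_to_SU2 :: "real ^ 4 \<Rightarrow> cmat2" where
  "vec4_to_SU2 x = su2 (vec4_fst x / norm x) (vec4_snd x / norm x)"

lemma vec4_to_SU2_mem: "x \<noteq> 0 \<Longrightarrow> vec4_to_SU2 x \<in> SU2"
  by (simp add: vec4_to_SU2_def su2_mem_SU2_iff norm_divide power_divide flip: add_divide_distrib norm_vec4)

text \<open>The projection intertwines the two left multiplications because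
  \<open>quat_mult p q\<close> preserves the norm by which it divides.\<close>

lemma su2_mult_vec4_to_SU2:
  assumes "(cmod p)\<^sup>2 + (cmod q)\<^sup>2 = 1"
  shows "su2 p q ** vec4_to_SU2 x = vec4_to_SU2 (quat_mult p q x)"
  unfolding vec4_to_SU2_def norm_quat_mult[OF assms]
  by (simp add: cmat2_eq_iff su2_def matrix_matrix_mult_def sum_2 quat_mult_def diff_divide_distrib add_divide_distrib)

lemma vec4_to_SU2_measurable: "vec4_to_SU2 \<in> borel_measurable borel"
proof (rule borel_measurable_continuous_countable_exceptions[where X = "{0}"])
  have "continuous_on (- {0}) vec4_fst" "continuous_on (- {0}) vec4_snd"
    unfolding vec4_fst_def[abs_def] vec4_snd_def[abs_def] by (auto intro!: continuous_intros)
  then show "continuous_on (- {0}) vec4_to_SU2"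
    unfolding vec4_to_SU2_def[abs_def] by (auto intro!: continuous_on_su2 continuous_intros)
qed auto

lemma matrix_mult_left_measurable: "(\<lambda>A. (g :: cmat2) ** A) \<in> borel_measurable borel"
  by (intro borel_measurable_continuous_onI continuous_on_matrix_mult continuous_intros)

lemma haar_SU2_exists: "\<exists>\<mu>. haar_SU2 \<mu>"
proof -
  \<comment> \<open>The origin is removed because its image lies outside \<open>SU2\<close>; it is a
    null set, so the volume is that of the ball.\<close>
  define S :: "(real ^ 4) set" where "S = ball 0 1 - {0}"
  define M where "M = uniform_measure lborel S"
  define \<mu> where "\<mu> = distr M borel vec4_to_SU2"
  have S [measurable]: "S \<in> sets borel"
    by (simp add: S_def)
  have S_iff: "x \<in> S \<longleftrightarrow> 0 < norm x \<and> norm x < 1" for x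
    by (auto simp: S_def)
  have sets_M: "sets M = sets borel"
    by (simp add: M_def)
  have S_emeasure: "emeasure lborel S = emeasure lborel (ball 0 1 :: (real ^ 4) set)"
    unfolding S_def by (rule emeasure_Diff_null_set) auto
  have S_fin: "emeasure lborel S \<noteq> \<infinity>"
    unfolding S_emeasure using emeasure_lborel_ball_finite[of "0 :: real ^ 4" 1] by simp
  have S_pos: "emeasure lborel S \<noteq> 0"
    unfolding S_emeasure using content_ball_pos[of 1 "0 :: real ^ 4"]
    by (metis measure_eq_emeasure_eq_ennreal ennreal_0 less_irrefl order_refl zero_less_one)
  interpret M: prob_space M
    unfolding M_def by (rule prob_space_uniform_measure[OF S_pos S_fin])
  have meas [measurable]: "vec4_to_SU2 \<in> measurable M borel"
    using vec4_to_SU2_measurable sets_M measurable_cong_sets by blast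
  have \<mu>_eq: "emeasure \<mu> B = emeasure lborel (S \<inter> vec4_to_SU2 -` B) / emeasure lborel S"
    if "B \<in> sets borel" for B
  proof -
    have "vec4_to_SU2 -` B \<in> sets borel"
      using measurable_sets[OF vec4_to_SU2_measurable that] by simp
    then show ?thesis
      unfolding \<mu>_def using that by (subst emeasure_distr[OF meas]) (auto simp: M_def)
  qed
  have prob: "prob_space \<mu>"
    unfolding \<mu>_def by (rule M.prob_space_distr[OF meas])
  have "S \<inter> vec4_to_SU2 -` SU2 = S"
    using vec4_to_SU2_mem by (auto simp: S_def)
  moreover have "SU2 \<in> sets borel"
    by (intro borel_closed compact_imp_closed compact_SU2)
  ultimately have \<mu>_SU2: "emeasure \<mu> SU2 = 1"
    using S_fin S_pos by (simp add: \<mu>_eq less_top)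
  have invariant: "distr \<mu> borel (\<lambda>A. g ** A) = \<mu>" if g_SU2: "g \<in> SU2" for g
  proof (rule measure_eqI)
    have sets_\<mu>: "sets \<mu> = sets borel"
      by (simp add: \<mu>_def)
    show "sets (distr \<mu> borel (\<lambda>A. g ** A)) = sets \<mu>"
      by (simp add: \<mu>_def)
    fix B assume "B \<in> sets (distr \<mu> borel (\<lambda>A. g ** A))"
    then have B: "B \<in> sets borel"
      by simp
    obtain p q where g: "g = su2 p q" and pq: "(cmod p)\<^sup>2 + (cmod q)\<^sup>2 = 1"
      using SU2_eq_su2[OF g_SU2] g_SU2 by (metis su2_mem_SU2_iff)
    let ?R = "quat_mult p q" and ?gB = "(\<lambda>A. g ** A) -` B"
    have orth: "orthogonal_transformation ?R"
      by (rule orthogonal_transformation_quat_mult[OF pq])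
    have gB: "?gB \<in> sets borel"
      using measurable_sets[OF matrix_mult_left_measurable B] by simp
    have sets_pre: "S \<inter> vec4_to_SU2 -` C \<in> sets borel" if "C \<in> sets borel" for C
      using measurable_sets[OF vec4_to_SU2_measurable that] S by auto
    have lmeas: "S \<inter> vec4_to_SU2 -` C \<in> lmeasurable" if "C \<in> sets borel" for C
    proof -
      have "bounded (S \<inter> vec4_to_SU2 -` C)"
        unfolding S_def by (rule bounded_subset[OF bounded_ball[of 0 1]]) auto
      then show ?thesis
        using sets_pre[OF that] by (intro bounded_set_imp_lmeasurable) auto
    qed
    \<comment> \<open>Translation by \<open>g\<close> becomes an orthogonal map: \<open>?R\<close>
      preserves \<open>S\<close> and carries the preimage of \<open>?gB\<close> onto that of
      \<open>B\<close>, so the two have equal volume.\<close>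
    have "?R ` (S \<inter> vec4_to_SU2 -` ?gB) = S \<inter> vec4_to_SU2 -` B"
    proof (intro equalityI subsetI)
      fix y assume y: "y \<in> S \<inter> vec4_to_SU2 -` B"
      obtain x where x: "y = ?R x"
        using orthogonal_transformation_surj[OF orth] by (metis surjD)
      have "norm x = norm y"
        unfolding x by (rule norm_quat_mult[OF pq, symmetric])
      then have "x \<in> S"
        using y by (simp add: S_iff)
      then show "y \<in> ?R ` (S \<inter> vec4_to_SU2 -` ?gB)"
        using y unfolding x by (intro imageI) (simp add: g su2_mult_vec4_to_SU2[OF pq])
    next
      fix y assume "y \<in> ?R ` (S \<inter> vec4_to_SU2 -` ?gB)"
      then obtain x where x: "y = ?R x" "x \<in> S" "g ** vec4_to_SU2 x \<in> B"
        by auto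
      have "norm y = norm x"
        unfolding x(1) by (rule norm_quat_mult[OF pq])
      then have "y \<in> S"
        using x(2) by (simp add: S_iff)
      then show "y \<in> S \<inter> vec4_to_SU2 -` B"
        using x by (simp add: g su2_mult_vec4_to_SU2[OF pq])
    qed
    then have "measure lebesgue (S \<inter> vec4_to_SU2 -` B) = measure lebesgue (S \<inter> vec4_to_SU2 -` ?gB)"
      using measure_orthogonal_image[OF orth lmeas[OF gB]] by simp
    then have "emeasure lebesgue (S \<inter> vec4_to_SU2 -` B) = emeasure lebesgue (S \<inter> vec4_to_SU2 -` ?gB)"
      using lmeas[OF B] lmeas[OF gB] by (simp add: emeasure_eq_measure2)
    then have "emeasure lborel (S \<inter> vec4_to_SU2 -` B) = emeasure lborel (S \<inter> vec4_to_SU2 -` ?gB)"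
      using sets_pre[OF B] sets_pre[OF gB] by simp
    then have "emeasure \<mu> ?gB = emeasure \<mu> B"
      using B gB by (simp add: \<mu>_eq)
    moreover have "emeasure (distr \<mu> borel (\<lambda>A. g ** A)) B = emeasure \<mu> ?gB"
      using B matrix_mult_left_measurable[of g] by (subst emeasure_distr) (simp_all add: \<mu>_def)
    ultimately show "emeasure (distr \<mu> borel (\<lambda>A. g ** A)) B = emeasure \<mu> B"
      by simp
  qed
  have "haar_SU2 \<mu>"
    unfolding haar_SU2_def using prob \<mu>_SU2 invariant by (simp add: \<mu>_def)
  then show ?thesis ..
qed

section \<open>Equidistribution\<close>

lemma integral_gprod_distr:
  fixes f :: "cmat2 \<Rightarrow> 'b :: euclidean_space"
  assumes f: "continuous_on UNIV f"
  shows "integral\<^sup>L (distr circle_unif borel (gprod k)) f = integral {0..1} (\<lambda>t. f (gprod k (cis (2 * pi * t))))"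
proof -
  \<comment> \<open>Continuity holds off 0, and one exceptional point does not affect Borel
    measurability.\<close>
  have gprod_meas: "gprod k \<in> borel_measurable borel"
    by (rule borel_measurable_continuous_countable_exceptions[where X = "{0}"]) (auto intro: continuous_on_gprod)
  have cis_meas: "(\<lambda>t. cis (2 * pi * t)) \<in> borel_measurable borel"
    by (intro borel_measurable_continuous_onI continuous_intros)
  have f_meas: "f \<in> borel_measurable borel"
    by (rule borel_measurable_continuous_onI[OF f])
  let ?h = "\<lambda>t. f (gprod k (cis (2 * pi * t)))"
  have h_meas: "?h \<in> borel_measurable borel"
    by (rule measurable_compose[OF measurable_compose[OF cis_meas gprod_meas] f_meas])
  have "continuous_on {0..1} (\<lambda>t. gprod k (cis (2 * pi * t)))"
    by (rule continuous_on_compose2[OF continuous_on_gprod]) (auto intro!: continuous_intros)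
  then have h_cont: "continuous_on {0..1} ?h"
    by (rule continuous_on_compose2[OF f]) auto
  have "integral\<^sup>L (distr circle_unif borel (gprod k)) f = integral\<^sup>L circle_unif (\<lambda>z. f (gprod k z))"
    using gprod_meas f_meas by (intro integral_distr) (auto simp: circle_unif_def)
  also have "\<dots> = integral\<^sup>L (uniform_measure lborel {0..1}) ?h"
    unfolding circle_unif_def using cis_meas measurable_compose[OF gprod_meas f_meas]
    by (intro integral_distr) auto
  also have "\<dots> = (LINT t : {0..1} | lborel. ?h t)"
    unfolding uniform_measure_def set_lebesgue_integral_def
    using h_meas by (subst integral_density[where g = "indicator {0..1}", symmetric])
      (auto simp: ennreal_indicator divide_ennreal_def)
  also have "\<dots> = integral {0..1} ?h"
    by (intro set_borel_integral_eq_integral borel_integrable_atLeastAtMost' h_cont)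
  finally show ?thesis .
qed

lemma bil_mult_left: "bil x (g ** A) y = bil (x v* g) A y"
  by (simp add: bil_def vector_matrix_mul_assoc)

lemma continuous_on_bil: "continuous_on A (\<lambda>B. bil x B y)"
  unfolding bil_def
  by (intro continuous_intros continuous_on_component continuous_on_vector_matrix_mult)

section \<open>Integration against an arbitrary Haar measure\<close>

locale haar =
  fixes \<mu> :: "cmat2 measure"
  assumes haar: "haar_SU2 \<mu>"
begin

sublocale prob_space \<mu>
  using haar by (simp add: haar_SU2_def)

lemma sets_haar: "sets \<mu> = sets borel"
  using haar by (simp add: haar_SU2_def)

lemma AE_SU2: "AE A in \<mu>. A \<in> SU2"
proof -
  have "prob SU2 = 1"
    using haar by (simp add: haar_SU2_def measure_def)
  then show ?thesis
    by (simp add: prob_eq_1 AE_prob_1)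
qed

lemma borel_measurable_haar: "f \<in> borel_measurable borel \<Longrightarrow> f \<in> borel_measurable \<mu>"
  using measurable_cong_sets[OF sets_haar refl] by blast

lemma integrable_continuous:
  fixes f :: "cmat2 \<Rightarrow> 'b :: {banach, second_countable_topology}"
  assumes "continuous_on UNIV f"
  shows "integrable \<mu> f"
proof -
  have "compact (f ` SU2)"
    using assms compact_SU2 by (intro compact_continuous_image) (auto intro: continuous_on_subset)
  then obtain B where "\<And>A. A \<in> SU2 \<Longrightarrow> norm (f A) \<le> B"
    using compact_imp_bounded bounded_iff by (metis imageI)
  then have "AE A in \<mu>. norm (f A) \<le> B"
    using AE_SU2 by auto
  then show ?thesis
    by (rule integrable_const_bound) (intro borel_measurable_haar borel_measurable_continuous_onI assms)
qed

lemma integral_left_mult: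
  fixes f :: "cmat2 \<Rightarrow> 'b :: {banach, second_countable_topology}"
  assumes "continuous_on UNIV f" "g \<in> SU2"
  shows "integral\<^sup>L \<mu> (\<lambda>A. f (g ** A)) = integral\<^sup>L \<mu> f"
proof -
  have "integral\<^sup>L (distr \<mu> borel (\<lambda>A. g ** A)) f = integral\<^sup>L \<mu> (\<lambda>A. f (g ** A))"
    by (intro integral_distr borel_measurable_haar matrix_mult_left_measurable borel_measurable_continuous_onI assms)
  then show ?thesis
    using haar assms(2) by (simp add: haar_SU2_def)
qed

text \<open>As a function of \<open>x\<close> the integral is homogeneous of degree \<open>n\<close>
  and invariant under \<open>SU2\<close> acting on rows, transitively on vectors of equal length.
  This reduces it to the first basis vector, where a diagonal element shows that it equals its own
  negative.\<close>

lemma integral_bil_power: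
  assumes n: "0 < n"
  shows "integral\<^sup>L \<mu> (\<lambda>A. bil x A y ^ n) = 0"
proof -
  define \<phi> where "\<phi> x = integral\<^sup>L \<mu> (\<lambda>A. bil x A y ^ n)" for x
  have inv: "\<phi> (x v* g) = \<phi> x" if "g \<in> SU2" for x g
    using integral_left_mult[OF continuous_on_power[OF continuous_on_bil] that, of x y n]
    by (simp add: \<phi>_def bil_mult_left)
  have scale: "\<phi> (s *s x) = s ^ n * \<phi> x" for s x
  proof -
    have "bil (s *s x) A y = s * bil x A y" for A
      using bil_add_scale(1)[of 0 s x A y] by (simp add: bil_def)
    then show ?thesis
      by (simp add: \<phi>_def power_mult_distrib)
  qed
  let ?e = "axis 1 1 :: complex ^ 2"
  have e: "?e v* su2 p q = vector [p, q]" for p q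
    by (simp add: vec_eq_iff forall_2 vector_matrix_mult_def sum_2 su2_def axis_def)
  \<comment> \<open>Chosen so that \<open>\<zeta> ^ n = -1\<close>: \<open>su2 \<zeta> 0\<close>
    scales the basis vector by \<open>\<zeta>\<close>, hence the integral by -1.\<close>
  define \<zeta> where "\<zeta> = cis (pi / real n)"
  have "?e v* su2 \<zeta> 0 = \<zeta> *s ?e"
    unfolding e by (simp add: vec_eq_iff forall_2 axis_def)
  moreover have "su2 \<zeta> 0 \<in> SU2"
    by (simp add: su2_mem_SU2_iff \<zeta>_def)
  moreover have "\<zeta> ^ n = -1"
    using n by (simp add: \<zeta>_def Complex.DeMoivre)
  ultimately have "- \<phi> ?e = \<phi> ?e"
    using scale[of \<zeta> ?e] inv[of "su2 \<zeta> 0" ?e] by simp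
  then have \<phi>_e: "\<phi> ?e = 0"
    by simp
  show ?thesis
  proof (cases "x = 0")
    case True
    then show ?thesis
      using n by (simp add: bil_def)
  next
    case False
    \<comment> \<open>A nonzero \<open>x\<close> is \<open>r\<close> times the first row of an
      element of \<open>SU2\<close>.\<close>
    define r where "r = sqrt ((cmod (x $ 1))\<^sup>2 + (cmod (x $ 2))\<^sup>2)"
    have "(cmod (x $ 1))\<^sup>2 + (cmod (x $ 2))\<^sup>2 \<noteq> 0"
      using False by (auto simp: vec_eq_iff forall_2 sum_power2_eq_zero_iff)
    then have r: "r\<^sup>2 = (cmod (x $ 1))\<^sup>2 + (cmod (x $ 2))\<^sup>2" "r \<noteq> 0"
      by (simp_all add: r_def)
    from r(2) have "su2 (x $ 1 / r) (x $ 2 / r) \<in> SU2"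
      by (simp add: su2_mem_SU2_iff norm_divide power_divide flip: add_divide_distrib r(1))
    moreover have "x = of_real r *s (?e v* su2 (x $ 1 / r) (x $ 2 / r))"
      unfolding e using r by (simp add: vec_eq_iff forall_2)
    ultimately have "\<phi> x = of_real r ^ n * \<phi> ?e"
      using scale inv by metis
    then have "\<phi> x = 0"
      by (simp add: \<phi>_e)
    then show ?thesis
      by (simp only: \<phi>_def)
  qed
qed

text \<open>Powers with \<open>n > 0\<close> have limit 0 and Haar integral 0, and constants have
  the same average on both sides. Agreement on \<open>SU2\<close> suffices because the walk and the
  Haar measure are both carried by it.\<close>

lemma SU2_span_tendsto:
  assumes "SU2_span f" "continuous_on UNIV f"
  shows "(\<lambda>k. integral {0..1} (\<lambda>t. f (gprod k (cis (2 * pi * t))))) \<longlonglongrightarrow> integral\<^sup>L \<mu> f"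
proof -
  obtain g where g: "bil_span g" and fg: "\<And>A. A \<in> SU2 \<Longrightarrow> f A = g A"
    using assms(1) by (auto simp: SU2_span_def)
  have "continuous_on UNIV g \<and>
    (\<lambda>k. integral {0..1} (\<lambda>t. g (gprod k (cis (2 * pi * t))))) \<longlonglongrightarrow> integral\<^sup>L \<mu> g"
    using g
  proof induction
    case (power c x y n)
    show ?case
    proof (intro conjI)
      show "continuous_on UNIV (\<lambda>A. c * bil x A y ^ n)"
        by (intro continuous_intros continuous_on_bil)
      show "(\<lambda>k. integral {0..1} (\<lambda>t. c * bil x (gprod k (cis (2 * pi * t))) y ^ n)) \<longlonglongrightarrow>
          integral\<^sup>L \<mu> (\<lambda>A. c * bil x A y ^ n)"
      proof (cases "n = 0")
        case True
        then show ?thesis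
          by (simp add: prob_space)
      next
        case False
        then show ?thesis
          using tendsto_mult_left[OF integral_bil_gprod_tendsto_0[of n x y], of c]
          by (simp add: integral_bil_power)
      qed
    qed
  next
    case (add f g)
    then have cont: "continuous_on UNIV f" "continuous_on UNIV g"
      by auto
    have int: "(\<lambda>t. h (gprod k (cis (2 * pi * t)))) integrable_on {0..1}" if "continuous_on UNIV h" for h :: "cmat2 \<Rightarrow> complex" and k
      by (intro integrable_continuous_interval continuous_on_compose2[OF that] continuous_on_compose2[OF continuous_on_gprod])
        (auto intro!: continuous_intros)
    have "integral\<^sup>L \<mu> (\<lambda>A. f A + g A) = integral\<^sup>L \<mu> f + integral\<^sup>L \<mu> g"
      by (intro Bochner_Integration.integral_add integrable_continuous cont)
    moreover have "integral {0..1} (\<lambda>t. f (gprod k (cis (2 * pi * t))) + g (gprod k (cis (2 * pi * t)))) =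
        integral {0..1} (\<lambda>t. f (gprod k (cis (2 * pi * t)))) + integral {0..1} (\<lambda>t. g (gprod k (cis (2 * pi * t))))" for k
      by (intro Henstock_Kurzweil_Integration.integral_add int cont)
    ultimately show ?case
      using add cont by (auto intro!: continuous_intros tendsto_add)
  qed
  then have cont: "continuous_on UNIV g" and
    lim: "(\<lambda>k. integral {0..1} (\<lambda>t. g (gprod k (cis (2 * pi * t))))) \<longlonglongrightarrow> integral\<^sup>L \<mu> g"
    by auto
  have "(\<lambda>t. f (gprod k (cis (2 * pi * t)))) = (\<lambda>t. g (gprod k (cis (2 * pi * t))))" for k
    by (simp add: fg gprod_mem_SU2)
  moreover have "integral\<^sup>L \<mu> f = integral\<^sup>L \<mu> g"
    using AE_SU2 fg
    by (intro integral_cong_AE borel_measurable_haar borel_measurable_continuous_onI assms(2) cont) auto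
  ultimately show ?thesis
    using lim by simp
qed

lemma weak_conv_gprod: "weak_conv_bc (\<lambda>k. distr circle_unif borel (gprod k)) \<mu>"
  unfolding weak_conv_bc_def
proof (intro allI impI, elim conjE)
  fix f :: "cmat2 \<Rightarrow> real"
  assume f: "continuous_on UNIV f"
  define I where "I h k = integral {0..1} (\<lambda>t. h (gprod k (cis (2 * pi * t))))" for h :: "cmat2 \<Rightarrow> real" and k
  have int: "(\<lambda>t. h (gprod k (cis (2 * pi * t)))) integrable_on {0..1}" if "continuous_on UNIV h" for h :: "cmat2 \<Rightarrow> real" and k
    by (intro integrable_continuous_interval continuous_on_compose2[OF that] continuous_on_compose2[OF continuous_on_gprod])
      (auto intro!: continuous_intros)
  have "(\<lambda>k. I f k) \<longlonglongrightarrow> integral\<^sup>L \<mu> f"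
  proof (rule LIMSEQ_I)
    fix \<epsilon> :: real assume "0 < \<epsilon>"
    then have \<epsilon>: "0 < \<epsilon> / 3"
      by simp
    \<comment> \<open>The approximation is uniform on \<open>SU2\<close>, so it controls the walk
      integrals for all \<open>k\<close> at once as well as the Haar integral.\<close>
    obtain p where p: "real_polynomial_function p" and fp: "\<And>A. A \<in> SU2 \<Longrightarrow> \<bar>f A - p A\<bar> < \<epsilon> / 3"
      using Stone_Weierstrass_real_polynomial_function[OF compact_SU2 continuous_on_subset[OF f] \<epsilon>] by blast
    have p_cont: "continuous_on UNIV p"
      using p by (intro continuous_at_imp_continuous_on ballI continuous_real_polymonial_function)
    \<comment> \<open>The span consists of complex-valued functions, so convergence is shown for the
      complex embedding first.\<close>
    have "(\<lambda>k. complex_of_real (I p k)) \<longlonglongrightarrow> complex_of_real (integral\<^sup>L \<mu> p)"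
    proof -
      have "integral {0..1} (\<lambda>t. complex_of_real (p (gprod k (cis (2 * pi * t))))) = complex_of_real (I p k)" for k
        unfolding I_def using has_integral_of_real[OF integrable_integral[OF int[OF p_cont]]] by (rule integral_unique)
      then show ?thesis
        using SU2_span_tendsto[OF SU2_span_real_polynomial_function[OF p] continuous_on_of_real[OF p_cont]] by simp
    qed
    then have "(\<lambda>k. I p k) \<longlonglongrightarrow> integral\<^sup>L \<mu> p"
      by (simp add: tendsto_of_real_iff)
    then obtain k0 where k0: "\<And>k. k0 \<le> k \<Longrightarrow> \<bar>I p k - integral\<^sup>L \<mu> p\<bar> < \<epsilon> / 3"
      using LIMSEQ_D[OF _ \<epsilon>] by (metis real_norm_def)
    have p_int: "\<bar>integral\<^sup>L \<mu> f - integral\<^sup>L \<mu> p\<bar> \<le> \<epsilon> / 3"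
    proof -
      have "\<bar>integral\<^sup>L \<mu> (\<lambda>A. f A - p A)\<bar> \<le> integral\<^sup>L \<mu> (\<lambda>A. \<bar>f A - p A\<bar>)"
        by (rule integral_abs_bound)
      also have "\<dots> \<le> integral\<^sup>L \<mu> (\<lambda>A. \<epsilon> / 3)"
        using AE_SU2 fp f p_cont
        by (intro integral_mono_AE integrable_continuous continuous_intros) (auto intro: less_imp_le)
      finally show ?thesis
        using f p_cont by (simp add: prob_space integrable_continuous)
    qed
    have p_walk: "\<bar>I f k - I p k\<bar> \<le> \<epsilon> / 3" for k
    proof -
      have "I f k - I p k = integral {0..1} (\<lambda>t. f (gprod k (cis (2 * pi * t))) - p (gprod k (cis (2 * pi * t))))"
        unfolding I_def by (rule Henstock_Kurzweil_Integration.integral_diff[symmetric]) (intro int f p_cont)+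
      also have "norm \<dots> \<le> integral {0..1} (\<lambda>t :: real. \<epsilon> / 3)"
        using fp[OF gprod_mem_SU2]
        by (intro integral_norm_bound_integral integrable_diff int f p_cont) (auto intro: less_imp_le)
      finally show ?thesis
        by simp
    qed
    have "norm (I f k - integral\<^sup>L \<mu> f) < \<epsilon>" if "k0 \<le> k" for k
      unfolding real_norm_def using p_int p_walk[of k] k0[OF that] by arith
    then show "\<exists>k0. \<forall>k\<ge>k0. norm (I f k - integral\<^sup>L \<mu> f) < \<epsilon>" by blast
  qed
  then show "(\<lambda>k. integral\<^sup>L (distr circle_unif borel (gprod k)) f) \<longlonglongrightarrow> integral\<^sup>L \<mu> f"
    by (simp add: integral_gprod_distr[OF f] I_def)
qed

end

theorem mainTheorem3:
  shows "(\<exists>\<mu>. haar_SU2 \<mu>) \<and>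
    (\<forall>\<mu>. haar_SU2 \<mu> \<longrightarrow> weak_conv_bc (\<lambda>k. distr circle_unif borel (gprod k)) \<mu>)"
  using haar_SU2_exists haar.weak_conv_gprod by (auto simp: haar_def)

end
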